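(* Consider the quantized ARX setting described in the context and suppose Assumptions (A1)–(A4) and (A6) hold. Let $c>0$ be the constant of (A3) and $c_2>0$ the constant of (A6). Let $c_4>0$ be a constant such that, almost surely, $\lambda^{(p^*,q_0)}_{max}(n)\le c_4(n+1)$ for all sufficiently large $n$, and let $\gamma'$ be a constant such that, almost surely, $\|\tilde\theta_n(q)\|\le\gamma'$ for all sufficiently large $n$ and every $0\le q\le q_0$. Let $\beta_1>0$ and $0<\beta_2<1$, and let the sequence $(v_n)$ satisfy $$\bigl[5(1+p^*c)\varepsilon+\beta_1\bigr]n\;\le\; v_n\;\le\;\frac{\beta_2}{q^*}\Bigl[b_{q_0}^2c_2-2\gamma'\sqrt{c_4(1+p^*c)\varepsilon}-3(1+p^*c)\varepsilon\Bigr]n .$$ Define $V_n(p,q):=\sigma_n(p,q)+v_n\,(p+q)$ and $\hat q_n:=\mathrm{argmin}_{0\le q\le q^*}V_n(p^*,q)$. Then $\hat q_n\to q_0$ almost surely as $n\to\infty$.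
   Context: System: $A(z)y_{n+1}=B(z)u_n+w_{n+1}$, $n\ge0$, where $z$ is the backward shift operator, $A(z)=1+a_1z+\dots+a_{p_0}z^{p_0}$ ($p_0\ge0$), $B(z)=b_1+b_2z+\dots+b_{q_0}z^{q_0-1}$ ($q_0\ge1$), $a_{p_0}\ne0$, $b_{q_0}\ne0$; i.e. $y_{n+1}=-a_1y_n-\dots-a_{p_0}y_{n-p_0+1}+b_1u_n+\dots+b_{q_0}u_{n-q_0+1}+w_{n+1}$. The parameters and orders are unknown. The noise $\{w_n\}$ is i.i.d. with $w_n\sim N(0,1)$, and $y_n=u_n=w_n=0$ for $n<0$. Given a quantization step $\varepsilon>0$, only $s_n=\varepsilon\lfloor y_n/\varepsilon+1/2\rfloor$ is observed. For integers $p,q\ge0$ define $\psi_i(p,q)=[s_i,\dots,s_{i-p+1},u_i,\dots,u_{i-q+1}]^\top$, where $s_i=u_i=0$ when $i\le0$, and $P_{n+1}(p,q)=\bigl(I+\sum_{i=0}^n\psi_i(p,q)\psi_i(p,q)^\top\bigr)^{-1}$; $\lambda^{(p,q)}_{min}(n)$, $\lambda^{(p,q)}_{max}(n)$ are the smallest and largest eigenvalues of $P^{-1}_{n+1}(p,q)$. Define $\bar\theta(p,q)=[-a_1,\dots,-a_p,b_1,\dots,b_q]^\top$ with $a_i=0$ for $i>p_0$, $b_j=0$ for $j>q_0$. Least squares estimate: $\theta_n(p,q)=P_n(p,q)\sum_{i=0}^{n-1}\psi_i(p,q)s_{i+1}$; $\sigma_n(p,q)=\sum_{i=0}^{n-1}(s_{i+1}-\theta_n(p,q)^\top\psi_i(p,q))^2$.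 For $0\le q\le q_0$, writing $\theta_n(p^*,q)=[-a_{1n}(q),\dots,-a_{p^*n}(q),b_{1n}(q),\dots,b_{qn}(q)]^\top$, set $\hat\theta_n(q)=[-a_{1n}(q),\dots,-a_{p^*n}(q),b_{1n}(q),\dots,b_{qn}(q),0,\dots,0]^\top$ (with $q_0-q$ zeros) and $\tilde\theta_n(q)=\bar\theta(p^*,q_0)-\hat\theta_n(q)$. Assumptions: (A1) $\{u_i\}$ is i.i.d., uniform on $[-\delta,\delta]$, $\delta>0$. (A2) $A(z)\ne0$ for all $|z|\le1$. (A3) There is $c>0$ with $|a_i|\le c$, $|b_j|\le c$ for all $i\le p_0$, $j\le q_0$, and $\varepsilon<\frac{1}{2(1+p_0c)}$. (A4) $(p_0,q_0)\in\{(p,q):0\le p\le p^*,1\le q\le q^*\}$ for known integers $p^*,q^*>0$. (A6) There is $c_2>0$ such that for all $0\le q\le q^*$, almost surely $\lambda^{(p^*,q)}_{min}(n)\ge c_2(n+1)$ for all sufficiently large $n$.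
   Formalization: The inputs u_n and the noise w_n are additionally assumed to be jointly independent (without this the claim can fail, e.g. when u_n is a function of w_{n+2}), and the unspecified initial value is taken as y_0 = w_0. *)

theory Defs
  imports "HOL-Probability.Probability"
          "Jordan_Normal_Form.Gauss_Jordan_Elimination"
          "Jordan_Normal_Form.Char_Poly"
begin

definition quant :: "real \<Rightarrow> real \<Rightarrow> real" where
  "quant eps y = eps * real_of_int \<lfloor>y / eps + 1/2\<rfloor>"

text \<open>Regressor psi_i(p,q) = [s_i,...,s_(i-p+1), u_i,...,u_(i-q+1)],
  with s_j = u_j = 0 for j <= 0 (index j = i - k is used only when k < i).\<close>
definition psi :: "(nat \<Rightarrow> real) \<Rightarrow> (nat \<Rightarrow> real) \<Rightarrow> nat \<Rightarrow> nat \<Rightarrow> nat \<Rightarrow> real vec" where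
  "psi s u p q i = vec (p + q) (\<lambda>k. if k < p then (if k < i then s (i - k) else 0)
                                   else (if k - p < i then u (i - (k - p)) else 0))"

definition Pinv :: "(nat \<Rightarrow> real) \<Rightarrow> (nat \<Rightarrow> real) \<Rightarrow> nat \<Rightarrow> nat \<Rightarrow> nat \<Rightarrow> real mat" where
  "Pinv s u p q n = mat (p + q) (p + q)
     (\<lambda>(j, k). (if j = k then 1 else 0) + (\<Sum>i<n. psi s u p q i $ j * psi s u p q i $ k))"

definition Pmat :: "(nat \<Rightarrow> real) \<Rightarrow> (nat \<Rightarrow> real) \<Rightarrow> nat \<Rightarrow> nat \<Rightarrow> nat \<Rightarrow> real mat" where
  "Pmat s u p q n = the (mat_inverse (Pinv s u p q n))"

definition lam_min :: "(nat \<Rightarrow> real) \<Rightarrow> (nat \<Rightarrow> real) \<Rightarrow> nat \<Rightarrow> nat \<Rightarrow> nat \<Rightarrow> real" where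
  "lam_min s u p q n = Min {k. eigenvalue (Pinv s u p q (Suc n)) k}"

definition lam_max :: "(nat \<Rightarrow> real) \<Rightarrow> (nat \<Rightarrow> real) \<Rightarrow> nat \<Rightarrow> nat \<Rightarrow> nat \<Rightarrow> real" where
  "lam_max s u p q n = Max {k. eigenvalue (Pinv s u p q (Suc n)) k}"

definition theta_ls :: "(nat \<Rightarrow> real) \<Rightarrow> (nat \<Rightarrow> real) \<Rightarrow> nat \<Rightarrow> nat \<Rightarrow> nat \<Rightarrow> real vec" where
  "theta_ls s u p q n = Pmat s u p q n *\<^sub>v
     vec (p + q) (\<lambda>j. \<Sum>i<n. psi s u p q i $ j * s (Suc i))"

definition sigma_ls :: "(nat \<Rightarrow> real) \<Rightarrow> (nat \<Rightarrow> real) \<Rightarrow> nat \<Rightarrow> nat \<Rightarrow> nat \<Rightarrow> real" where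
  "sigma_ls s u p q n = (\<Sum>i<n. (s (Suc i) - theta_ls s u p q n \<bullet> psi s u p q i)\<^sup>2)"

definition theta_bar :: "(nat \<Rightarrow> real) \<Rightarrow> (nat \<Rightarrow> real) \<Rightarrow> nat \<Rightarrow> nat \<Rightarrow> nat \<Rightarrow> nat \<Rightarrow> real vec" where
  "theta_bar a b p0 q0 p q = vec (p + q) (\<lambda>k. if k < p then - (if k + 1 \<le> p0 then a (k + 1) else 0)
                                             else (if k - p + 1 \<le> q0 then b (k - p + 1) else 0))"

definition theta_hat :: "(nat \<Rightarrow> real) \<Rightarrow> (nat \<Rightarrow> real) \<Rightarrow> nat \<Rightarrow> nat \<Rightarrow> nat \<Rightarrow> nat \<Rightarrow> real vec" where
  "theta_hat s u pstar q0 q n = vec (pstar + q0)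
     (\<lambda>k. if k < pstar + q then theta_ls s u pstar q n $ k else 0)"

definition theta_tilde :: "(nat \<Rightarrow> real) \<Rightarrow> (nat \<Rightarrow> real) \<Rightarrow> nat \<Rightarrow> nat \<Rightarrow>
    (nat \<Rightarrow> real) \<Rightarrow> (nat \<Rightarrow> real) \<Rightarrow> nat \<Rightarrow> nat \<Rightarrow> nat \<Rightarrow> real vec" where
  "theta_tilde a b p0 q0 s u pstar q n = theta_bar a b p0 q0 pstar q0 - theta_hat s u pstar q0 q n"

definition vnorm :: "real vec \<Rightarrow> real" where
  "vnorm v = sqrt (v \<bullet> v)"

definition Vcrit :: "(nat \<Rightarrow> real) \<Rightarrow> (nat \<Rightarrow> real) \<Rightarrow> (nat \<Rightarrow> real) \<Rightarrow> nat \<Rightarrow> nat \<Rightarrow> nat \<Rightarrow> real" where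
  "Vcrit v s u n p q = sigma_ls s u p q n + v n * real (p + q)"

end

theory Submission
  imports Defs "HOL-Library.Discrete_Functions" "HOL-Complex_Analysis.Cauchy_Integral_Formula"
begin

text \<open>With \<open>\<theta>\<close> the true parameter, the quantized output satisfies \<open>s (i + 1) = \<theta> \<bullet> \<psi> i + d i + W i\<close>,
  where \<open>d\<close> collects quantization errors and is bounded by \<open>m = (1 + p0 c) eps / 2\<close>, and \<open>W\<close> is the
  white noise up to finitely many initial terms. By stability \<open>y\<close> has bounded second moments, so the
  products of \<open>w (i + 1)\<close> with the regressor entries are uncorrelated with bounded second moments and
  average to 0 almost surely; the rest of the argument is pathwise. Of the least squares estimate
  only its minimality is used: the residual sum at order \<open>q0\<close> is at most \<open>rss + O(1)\<close> with
  \<open>rss = \<Sum> (d i + W i)\<^sup>2\<close>. For larger \<open>q\<close>, completing the square bounds it below by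
  \<open>rss - m\<^sup>2 n - o(n)\<close>. For smaller \<open>q\<close> the parameter error has norm at least \<open>\<bar>b q0\<bar>\<close>, so the
  residual sum exceeds \<open>rss\<close> by \<open>(b q0)\<^sup>2 c2 n - 2 \<gamma>' m sqrt c4 n - o(n)\<close>.\<close>

section \<open>Eigenvalue bounds for real symmetric quadratic forms\<close>

text \<open>The quantization error \<open>d\<close> does not average out: it is produced by the same
  path as the regressors and may correlate with them, so it costs terms of order n, and the penalty
  that outweighs them grows linearly.

  The delicate term is the scalar product of the parameter error x with \<open>noise_corr\<close>,
  because x depends on n and on the path. It is o(n) as soon as x stays bounded. For
  \<open>q < q0\<close> the bound is the given \<gamma>'; for \<open>q > q0\<close> it is derived
  from minimality and (A6), by playing the quadratic growth in x of the regression sum against the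
  upper bound on the residual sum.

  \<open>lam_min\<close> and \<open>lam_max\<close> are extrema of sets of eigenvalues, whereas the
  estimates need quadratic forms; hence the Rayleigh bounds.\<close>

lemma scalar_prod_mult_mat_vec_commute:
  fixes A :: "real mat"
  assumes A: "A \<in> carrier_mat n n" and sym: "transpose_mat A = A"
    and x: "x \<in> carrier_vec n" and y: "y \<in> carrier_vec n"
  shows "x \<bullet> (A *\<^sub>v y) = y \<bullet> (A *\<^sub>v x)"
proof -
  have "y \<bullet> (A *\<^sub>v x) = (transpose_mat A *\<^sub>v y) \<bullet> x"
    using transpose_vec_mult_scalar[of A n n x y] A x y by auto
  also have "\<dots> = x \<bullet> (A *\<^sub>v y)"
    using A x y by (simp add: sym comm_scalar_prod[of _ n])
  finally show ?thesis by simp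
qed

text \<open>The constant is the crude sum of absolute entries; the summand 1 makes it strictly
  positive, since \<open>symmetric_min_eigenvalue\<close> divides by it.\<close>

lemma quadratic_form_bounded:
  fixes A :: "real mat"
  assumes A: "A \<in> carrier_mat n n"
  obtains C where "C > 0" "\<And>x. x \<in> carrier_vec n \<Longrightarrow> \<bar>x \<bullet> (A *\<^sub>v x)\<bar> \<le> C * (x \<bullet> x)"
proof
  let ?C = "1 + (\<Sum>i<n. \<Sum>j<n. \<bar>A $$ (i, j)\<bar>)"
  show "?C > 0" by (intro add_pos_nonneg sum_nonneg) auto
  fix x :: "real vec" assume x: "x \<in> carrier_vec n"
  have N: "x \<bullet> x = (\<Sum>i<n. (x $ i)\<^sup>2)"
    using x by (simp add: scalar_prod_def power2_eq_square atLeast0LessThan)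
  have le: "\<bar>x $ i\<bar> * \<bar>x $ j\<bar> \<le> x \<bullet> x" if "i < n" "j < n" for i j
  proof -
    have "(x $ i)\<^sup>2 \<le> x \<bullet> x" "(x $ j)\<^sup>2 \<le> x \<bullet> x"
      unfolding N using that by (auto intro!: member_le_sum)
    moreover have "2 * (\<bar>x $ i\<bar> * \<bar>x $ j\<bar>) \<le> (x $ i)\<^sup>2 + (x $ j)\<^sup>2"
      using sum_squares_bound[of "\<bar>x $ i\<bar>" "\<bar>x $ j\<bar>"] by simp
    ultimately show ?thesis by simp
  qed
  have "x \<bullet> (A *\<^sub>v x) = (\<Sum>i<n. \<Sum>j<n. A $$ (i, j) * (x $ i * x $ j))"
    using A x by (simp add: scalar_prod_def atLeast0LessThan sum_distrib_left ac_simps)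
  also have "\<bar>\<dots>\<bar> \<le> (\<Sum>i<n. \<Sum>j<n. \<bar>A $$ (i, j)\<bar> * (\<bar>x $ i\<bar> * \<bar>x $ j\<bar>))"
    by (intro order_trans[OF sum_abs] sum_mono) (simp add: abs_mult)
  also have "\<dots> \<le> (\<Sum>i<n. \<Sum>j<n. \<bar>A $$ (i, j)\<bar> * (x \<bullet> x))"
    using le by (intro sum_mono mult_left_mono) auto
  also have "\<dots> \<le> ?C * (x \<bullet> x)"
    by (simp add: N sum_nonneg flip: sum_distrib_right) (simp add: algebra_simps sum_nonneg)
  finally show "\<bar>x \<bullet> (A *\<^sub>v x)\<bar> \<le> ?C * (x \<bullet> x)" .
qed

text \<open>Needed for \<open>Min\<close> and \<open>Max\<close> over the spectrum to bound its
  members.\<close>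

lemma finite_eigenvalues:
  fixes A :: "'a :: field mat"
  assumes A: "A \<in> carrier_mat n n"
  shows "finite {k. eigenvalue A k}"
proof -
  have "char_poly A \<noteq> 0" using degree_monic_char_poly[OF A] by auto
  then show ?thesis
    unfolding eigenvalue_root_char_poly[OF A] by (rule poly_roots_finite)
qed

lemma scalar_prod_self_pos:
  fixes x :: "real vec"
  assumes "x \<in> carrier_vec n" "x \<noteq> 0\<^sub>v n"
  shows "0 < x \<bullet> x"
proof -
  obtain i where i: "i < n" "x $ i \<noteq> 0" using assms by (metis carrier_vecD eq_vecI index_zero_vec)
  have "0 < (x $ i)\<^sup>2" using i by simp
  also have "\<dots> \<le> (\<Sum>i<n. (x $ i)\<^sup>2)" using i by (intro member_le_sum) auto
  finally show ?thesis using assms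
    by (simp add: scalar_prod_def power2_eq_square atLeast0LessThan)
qed

text \<open>The infimum \<open>\<mu>\<close> of the Rayleigh quotient is an eigenvalue without any compactness: if
  \<open>A - \<mu>\<close> were invertible, its positive semidefinite form would be bounded below by a positive
  multiple of the norm, contradicting the choice of \<open>\<mu>\<close>.\<close>

lemma symmetric_min_eigenvalue:
  fixes A :: "real mat"
  assumes A: "A \<in> carrier_mat n n" and sym: "transpose_mat A = A" and n: "0 < n"
  obtains \<mu> where "eigenvalue A \<mu>"
    "\<And>x. x \<in> carrier_vec n \<Longrightarrow> \<mu> * (x \<bullet> x) \<le> x \<bullet> (A *\<^sub>v x)"
proof
  define R where "R = (\<lambda>x. x \<bullet> (A *\<^sub>v x) / (x \<bullet> x)) ` {x \<in> carrier_vec n. x \<noteq> 0\<^sub>v n}"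
  define \<mu> where "\<mu> = Inf R"
  obtain C where C: "\<And>x. x \<in> carrier_vec n \<Longrightarrow> \<bar>x \<bullet> (A *\<^sub>v x)\<bar> \<le> C * (x \<bullet> x)"
    using quadratic_form_bounded[OF A] by metis
  have "- C \<le> r" if "r \<in> R" for r
    using that C scalar_prod_self_pos unfolding R_def by (fastforce simp: field_simps abs_le_iff)
  then have bdd: "bdd_below R" by (rule bdd_belowI)
  have "unit_vec n 0 \<in> {x \<in> carrier_vec n. x \<noteq> (0\<^sub>v n :: real vec)}" 
    using n by (auto simp: unit_vec_def vec_eq_iff)
  then have ne: "R \<noteq> {}" unfolding R_def by blast
  show low: "\<mu> * (x \<bullet> x) \<le> x \<bullet> (A *\<^sub>v x)" if x: "x \<in> carrier_vec n" for x
  proof (cases "x = 0\<^sub>v n")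
    case False
    then have "\<mu> \<le> x \<bullet> (A *\<^sub>v x) / (x \<bullet> x)"
      unfolding \<mu>_def using x bdd by (intro cInf_lower) (auto simp: R_def)
    then show ?thesis using scalar_prod_self_pos[OF x False] by (simp add: field_simps)
  qed (use A in auto)
  show "eigenvalue A \<mu>"
  proof (rule ccontr)
    assume "\<not> eigenvalue A \<mu>"
    define B where "B = char_matrix A \<mu>"
    have B: "B \<in> carrier_mat n n" using A by (simp add: B_def char_matrix_def)
    have "det B \<noteq> 0" using \<open>\<not> eigenvalue A \<mu>\<close> eigenvalue_det[OF A] by (simp add: B_def)
    then obtain B' where B': "B' \<in> carrier_mat n n" "B * B' = 1\<^sub>m n"
      using det_non_zero_imp_unit[OF B] by (auto simp: Units_def ring_mat_def)
    have Bx: "B *\<^sub>v x = A *\<^sub>v x - \<mu> \<cdot>\<^sub>v x" if "x \<in> carrier_vec n" for x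
      using that A unfolding B_def char_matrix_def
      by (subst minus_add_uminus_vec[of _ n]) (auto simp: add_mult_distrib_mat_vec[of _ n n])
    have symB: "x \<bullet> (B *\<^sub>v z) = z \<bullet> (B *\<^sub>v x)" if "x \<in> carrier_vec n" "z \<in> carrier_vec n" for x z
      using that A scalar_prod_mult_mat_vec_commute[OF A sym that]
      by (simp add: Bx scalar_prod_minus_distrib[of _ n] comm_scalar_prod[of x n z])
    have psd: "0 \<le> x \<bullet> (B *\<^sub>v x)" if "x \<in> carrier_vec n" for x
      using that A low[OF that] by (simp add: Bx scalar_prod_minus_distrib[of _ n])
    obtain K where K: "K > 0" "\<And>x. x \<in> carrier_vec n \<Longrightarrow> \<bar>x \<bullet> (B' *\<^sub>v x)\<bar> \<le> K * (x \<bullet> x)"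
      using quadratic_form_bounded[OF B'(1)] by metis
    have gap: "x \<bullet> x / K \<le> x \<bullet> (B *\<^sub>v x)" if x: "x \<in> carrier_vec n" for x
    proof -
      define z where "z = B' *\<^sub>v x"
      have z: "z \<in> carrier_vec n" using B' x by (simp add: z_def)
      have Bz: "B *\<^sub>v z = x" using B B' x
        by (simp add: z_def flip: assoc_mult_mat_vec)
      \<comment> \<open>The form of \<open>B\<close> is nonnegative at \<open>x - t z\<close>, where
        \<open>B z = x\<close>. This gives a quadratic in \<open>t\<close>, and \<open>1 / K\<close>
        is where its upper estimate is smallest.\<close>
      define t where "t = 1 / K"
      have "0 \<le> (x - t \<cdot>\<^sub>v z) \<bullet> (B *\<^sub>v (x - t \<cdot>\<^sub>v z))" using x z by (intro psd) auto
      also have "\<dots> = x \<bullet> (B *\<^sub>v x) - 2 * t * (x \<bullet> x) + t\<^sup>2 * (z \<bullet> x)"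
        using x z B symB[OF x z]
        by (simp add: mult_minus_distrib_mat_vec[of _ n n] minus_scalar_prod_distrib[of _ n]
            scalar_prod_minus_distrib[of _ n] mult_mat_vec Bz power2_eq_square algebra_simps)
      also have "z \<bullet> x \<le> K * (x \<bullet> x)"
        using K(2)[OF x] comm_scalar_prod[OF z x] by (simp add: z_def)
      finally have "0 \<le> x \<bullet> (B *\<^sub>v x) - 2 * t * (x \<bullet> x) + t\<^sup>2 * (K * (x \<bullet> x))"
        by (simp add: mult_left_mono)
      then show ?thesis using K(1) by (simp add: t_def power2_eq_square)
    qed
    have "\<mu> + 1 / K \<le> r" if "r \<in> R" for r
    proof -
      obtain x where x: "x \<in> carrier_vec n" "x \<noteq> 0\<^sub>v n" and r: "r = x \<bullet> (A *\<^sub>v x) / (x \<bullet> x)"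
        using \<open>r \<in> R\<close> by (auto simp: R_def)
      have "(\<mu> + 1 / K) * (x \<bullet> x) \<le> x \<bullet> (A *\<^sub>v x)"
        using gap[OF x(1)] x(1) A by (simp add: Bx scalar_prod_minus_distrib[of _ n] algebra_simps)
      then show ?thesis using scalar_prod_self_pos[OF x] by (simp add: r field_simps)
    qed
    then have "\<mu> + 1 / K \<le> \<mu>" unfolding \<mu>_def by (intro cInf_greatest ne)
    then show False using K(1) by simp
  qed
qed

lemma Min_eigenvalue_rayleigh:
  fixes A :: "real mat"
  assumes A: "A \<in> carrier_mat n n" and sym: "transpose_mat A = A" and n: "0 < n"
    and x: "x \<in> carrier_vec n"
  shows "Min {k. eigenvalue A k} * (x \<bullet> x) \<le> x \<bullet> (A *\<^sub>v x)"
proof -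
  obtain \<mu> where \<mu>: "eigenvalue A \<mu>" "\<mu> * (x \<bullet> x) \<le> x \<bullet> (A *\<^sub>v x)"
    using symmetric_min_eigenvalue[OF A sym n] x by metis
  have "Min {k. eigenvalue A k} \<le> \<mu>" using finite_eigenvalues[OF A] \<mu>(1) by simp
  moreover have "0 \<le> x \<bullet> x" using x scalar_prod_self_pos[OF x] by (cases "x = 0\<^sub>v n") auto
  ultimately show ?thesis using \<mu>(2) by (meson mult_right_mono order_trans)
qed

text \<open>The smallest eigenvalue of \<open>- A\<close> is the negative of an eigenvalue of
  \<open>A\<close>.\<close>

lemma Max_eigenvalue_rayleigh:
  fixes A :: "real mat"
  assumes A: "A \<in> carrier_mat n n" and sym: "transpose_mat A = A" and n: "0 < n"
    and x: "x \<in> carrier_vec n"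
  shows "x \<bullet> (A *\<^sub>v x) \<le> Max {k. eigenvalue A k} * (x \<bullet> x)"
proof -
  have mA: "- A \<in> carrier_mat n n" "transpose_mat (- A) = - A"
    using A sym by (auto simp: transpose_uminus)
  have neg: "(- A) *\<^sub>v z = - (A *\<^sub>v z)" if "z \<in> carrier_vec n" for z
    using that A by (auto simp: vec_eq_iff)
  obtain \<mu> where \<mu>: "eigenvalue (- A) \<mu>" "\<mu> * (x \<bullet> x) \<le> x \<bullet> ((- A) *\<^sub>v x)"
    using symmetric_min_eigenvalue[OF mA n] x by metis
  obtain z where z: "z \<in> carrier_vec n" "z \<noteq> 0\<^sub>v n" "(- A) *\<^sub>v z = \<mu> \<cdot>\<^sub>v z"
    using \<mu>(1) mA A unfolding eigenvalue_def eigenvector_def by auto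
  have "A *\<^sub>v z = (- \<mu>) \<cdot>\<^sub>v z"
    using z A neg[OF z(1)] by (auto simp: vec_eq_iff)
  then have "eigenvalue A (- \<mu>)" using z A unfolding eigenvalue_def eigenvector_def by auto
  then have "- \<mu> \<le> Max {k. eigenvalue A k}" using finite_eigenvalues[OF A] by simp
  moreover have "0 \<le> x \<bullet> x" using x scalar_prod_self_pos[OF x] by (cases "x = 0\<^sub>v n") auto
  moreover have "x \<bullet> (A *\<^sub>v x) \<le> (- \<mu>) * (x \<bullet> x)"
    using \<mu>(2) x A by (simp add: neg)
  ultimately show ?thesis by (meson mult_right_mono order_trans)
qed

section \<open>Regularised least squares and order selection along a path\<close>

lemma psi_carrier [simp]: "psi s u p q i \<in> carrier_vec (p + q)"
  by (simp add: psi_def)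

lemma Pinv_carrier [simp]: "Pinv s u p q n \<in> carrier_mat (p + q) (p + q)"
  by (simp add: Pinv_def)

lemma transpose_Pinv: "transpose_mat (Pinv s u p q n) = Pinv s u p q n"
  by (auto simp: Pinv_def mat_eq_iff mult.commute)

lemma scalar_prod_eq_sum:
  "y \<in> carrier_vec n \<Longrightarrow> x \<bullet> y = (\<Sum>k<n. x $ k * y $ k)"
  by (simp add: scalar_prod_def atLeast0LessThan)

text \<open>\<open>Pinv\<close> is the identity plus a sum of rank-one matrices. This identity
  translates between its quadratic form and sums of squared regression values.\<close>

lemma scalar_prod_Pinv:
  assumes z: "z \<in> carrier_vec (p + q)" and x: "x \<in> carrier_vec (p + q)"
  shows "z \<bullet> (Pinv s u p q n *\<^sub>v x)
         = z \<bullet> x + (\<Sum>i<n. (z \<bullet> psi s u p q i) * (x \<bullet> psi s u p q i))"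
proof -
  let ?N = "p + q" and ?\<psi> = "\<lambda>i. psi s u p q i"
  have "z \<bullet> (Pinv s u p q n *\<^sub>v x)
        = (\<Sum>j<?N. z $ j * (\<Sum>k<?N. ((if j = k then 1 else 0) + (\<Sum>i<n. ?\<psi> i $ j * ?\<psi> i $ k)) * x $ k))"
    using z x by (simp add: Pinv_def scalar_prod_def atLeast0LessThan)
  also have "\<dots> = (\<Sum>j<?N. z $ j * (x $ j + (\<Sum>i<n. ?\<psi> i $ j * (\<Sum>k<?N. x $ k * ?\<psi> i $ k))))"
  proof (intro sum.cong refl arg_cong2[of _ _ _ _ "(*)"])
    fix j assume j: "j \<in> {..<?N}"
    have "(\<Sum>k<?N. ((if j = k then 1 else 0) + (\<Sum>i<n. ?\<psi> i $ j * ?\<psi> i $ k)) * x $ k)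
        = (\<Sum>k<?N. (if j = k then x $ k else 0)) + (\<Sum>k<?N. \<Sum>i<n. ?\<psi> i $ j * ?\<psi> i $ k * x $ k)"
      by (subst sum.distrib[symmetric], intro sum.cong) (auto simp: distrib_right sum_distrib_right)
    also have "(\<Sum>k<?N. \<Sum>i<n. ?\<psi> i $ j * ?\<psi> i $ k * x $ k)
        = (\<Sum>i<n. ?\<psi> i $ j * (\<Sum>k<?N. x $ k * ?\<psi> i $ k))"
      by (subst sum.swap) (simp add: sum_distrib_left ac_simps)
    finally show "(\<Sum>k<?N. ((if j = k then 1 else 0) + (\<Sum>i<n. ?\<psi> i $ j * ?\<psi> i $ k)) * x $ k)
        = x $ j + (\<Sum>i<n. ?\<psi> i $ j * (\<Sum>k<?N. x $ k * ?\<psi> i $ k))"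
      using j by simp
  qed
  also have "\<dots> = z \<bullet> x + (\<Sum>j<?N. \<Sum>i<n. z $ j * (?\<psi> i $ j * (x \<bullet> ?\<psi> i)))"
    using x by (simp add: scalar_prod_eq_sum[of _ ?N] distrib_left sum.distrib sum_distrib_left)
  also have "(\<Sum>j<?N. \<Sum>i<n. z $ j * (?\<psi> i $ j * (x \<bullet> ?\<psi> i)))
      = (\<Sum>i<n. (z \<bullet> ?\<psi> i) * (x \<bullet> ?\<psi> i))"
    by (subst sum.swap) (simp add: scalar_prod_eq_sum[of _ ?N] sum_distrib_right mult.assoc)
  finally show ?thesis .
qed

lemma scalar_prod_self_nonneg: "0 \<le> x \<bullet> (x :: real vec)"
  by (auto simp: scalar_prod_def intro!: sum_nonneg)

text \<open>The identity summand makes the form positive definite, so the kernel is trivial and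
  \<open>mat_inverse\<close> does return an inverse; \<open>the\<close> in \<open>Pmat\<close> is
  therefore harmless.\<close>

lemma Pinv_inverse:
  assumes "x \<in> carrier_vec (p + q)"
  shows "Pmat s u p q n *\<^sub>v x \<in> carrier_vec (p + q)"
    and "Pinv s u p q n *\<^sub>v (Pmat s u p q n *\<^sub>v x) = x"
proof -
  let ?P = "Pinv s u p q n"
  have "det ?P \<noteq> 0"
  proof
    assume "det ?P = 0"
    then obtain z where z: "z \<in> carrier_vec (p + q)" "z \<noteq> 0\<^sub>v (p + q)" "?P *\<^sub>v z = 0\<^sub>v (p + q)"
      using det_0_iff_vec_prod_zero[OF Pinv_carrier] by blast
    then have "z \<bullet> z + (\<Sum>i<n. (z \<bullet> psi s u p q i) * (z \<bullet> psi s u p q i)) = 0"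
      using scalar_prod_Pinv[OF z(1) z(1), of s u n] by simp
    moreover have "0 \<le> (\<Sum>i<n. (z \<bullet> psi s u p q i) * (z \<bullet> psi s u p q i))"
      by (intro sum_nonneg) auto
    ultimately show False using scalar_prod_self_pos[OF z(1,2)] by simp
  qed
  then have "?P \<in> Units (ring_mat TYPE(real) (p + q) ())"
    by (rule det_non_zero_imp_unit[OF Pinv_carrier])
  then obtain B where "mat_inverse ?P = Some B"
    using mat_inverse(1)[OF Pinv_carrier, where b = "()"] by (cases "mat_inverse ?P") auto
  then have "Pmat s u p q n = B" "?P * B = 1\<^sub>m (p + q)" "B \<in> carrier_mat (p + q) (p + q)"
    using mat_inverse(2)[OF Pinv_carrier] by (auto simp: Pmat_def)
  then show "Pmat s u p q n *\<^sub>v x \<in> carrier_vec (p + q)" "?P *\<^sub>v (Pmat s u p q n *\<^sub>v x) = x"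
    using assms by (auto simp flip: assoc_mult_mat_vec[OF Pinv_carrier])
qed

lemma theta_ls_carrier [simp]: "theta_ls s u p q n \<in> carrier_vec (p + q)"
  unfolding theta_ls_def by (rule Pinv_inverse) simp

text \<open>The derivative in direction \<open>z\<close> of the regularised least squares functional
  vanishes at the estimate.\<close>

lemma theta_ls_normal_equation:
  assumes z: "z \<in> carrier_vec (p + q)"
  shows "z \<bullet> theta_ls s u p q n
           + (\<Sum>i<n. (z \<bullet> psi s u p q i) * (theta_ls s u p q n \<bullet> psi s u p q i))
         = (\<Sum>i<n. (z \<bullet> psi s u p q i) * s (Suc i))"
proof -
  have "z \<bullet> theta_ls s u p q n
          + (\<Sum>i<n. (z \<bullet> psi s u p q i) * (theta_ls s u p q n \<bullet> psi s u p q i))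
        = z \<bullet> vec (p + q) (\<lambda>j. \<Sum>i<n. psi s u p q i $ j * s (Suc i))"
    unfolding scalar_prod_Pinv[OF z theta_ls_carrier, symmetric]
    by (simp add: theta_ls_def Pinv_inverse)
  also have "\<dots> = (\<Sum>j<p + q. \<Sum>i<n. z $ j * psi s u p q i $ j * s (Suc i))"
    by (simp add: scalar_prod_eq_sum[of _ "p + q"] sum_distrib_left ac_simps)
  also have "\<dots> = (\<Sum>i<n. (z \<bullet> psi s u p q i) * s (Suc i))"
    by (subst sum.swap) (simp add: scalar_prod_eq_sum[of _ "p + q"] sum_distrib_right)
  finally show ?thesis .
qed

text \<open>Because of the identity in \<open>Pinv\<close> the estimate is a ridge regression, so
  the squared norm of the parameter enters both sides. The normal equation removes the cross term,
  and what remains is a sum of squares.\<close>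

lemma theta_ls_minimises:
  assumes x: "x \<in> carrier_vec (p + q)"
  shows "sigma_ls s u p q n + theta_ls s u p q n \<bullet> theta_ls s u p q n
         \<le> (\<Sum>i<n. (s (Suc i) - x \<bullet> psi s u p q i)\<^sup>2) + x \<bullet> x"
proof -
  let ?\<theta> = "theta_ls s u p q n" and ?\<psi> = "psi s u p q"
  define z where "z = x - ?\<theta>"
  have z: "z \<in> carrier_vec (p + q)" using x by (simp add: z_def)
  have zx: "x \<bullet> ?\<psi> i = ?\<theta> \<bullet> ?\<psi> i + z \<bullet> ?\<psi> i" for i
    using x by (simp add: z_def minus_scalar_prod_distrib[of _ "p + q"])
  have "z \<bullet> z = x \<bullet> x - 2 * (z \<bullet> ?\<theta>) - ?\<theta> \<bullet> ?\<theta>"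
    using x by (simp add: z_def minus_scalar_prod_distrib[of _ "p + q"]
        scalar_prod_minus_distrib[of _ "p + q"] comm_scalar_prod[of x "p + q" ?\<theta>])
  moreover have "(\<Sum>i<n. (s (Suc i) - x \<bullet> ?\<psi> i)\<^sup>2) = sigma_ls s u p q n
      - 2 * ((\<Sum>i<n. (z \<bullet> ?\<psi> i) * s (Suc i)) - (\<Sum>i<n. (z \<bullet> ?\<psi> i) * (?\<theta> \<bullet> ?\<psi> i)))
      + (\<Sum>i<n. (z \<bullet> ?\<psi> i)\<^sup>2)"
    unfolding sigma_ls_def zx
    by (simp add: sum_subtractf[symmetric] sum_distrib_left sum.distrib[symmetric]
        power2_eq_square algebra_simps)
  moreover have "0 \<le> z \<bullet> z" "0 \<le> (\<Sum>i<n. (z \<bullet> ?\<psi> i)\<^sup>2)"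
    by (simp_all add: scalar_prod_self_nonneg sum_nonneg)
  ultimately show ?thesis
    using theta_ls_normal_equation[OF z, of s u n] by simp
qed

section \<open>Residual sums under bounded disturbance and averaging noise\<close>

lemma Cauchy_Schwarz_vnorm:
  assumes "x \<in> carrier_vec n" "y \<in> carrier_vec n"
  shows "\<bar>x \<bullet> y\<bar> \<le> vnorm x * vnorm y"
proof -
  have "(x \<bullet> y)\<^sup>2 \<le> (x \<bullet> x) * (y \<bullet> y)"
    using Cauchy_Schwarz_ineq_sum[of "\<lambda>k. x $ k" "\<lambda>k. y $ k" "{..<n}"] assms
    by (simp add: scalar_prod_eq_sum[of _ n] power2_eq_square)
  then show ?thesis
    unfolding vnorm_def by (metis real_sqrt_abs real_sqrt_le_iff real_sqrt_mult)
qed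

lemma vnorm_nonneg [simp]: "0 \<le> vnorm x"
  by (simp add: vnorm_def scalar_prod_self_nonneg)

lemma vnorm_squared: "(vnorm x)\<^sup>2 = x \<bullet> x"
  by (simp add: vnorm_def scalar_prod_self_nonneg)

text \<open>Kept as a vector so that Cauchy-Schwarz controls the noise in all directions at once;
  the directions used later change with n.\<close>

definition noise_corr :: "(nat \<Rightarrow> real) \<Rightarrow> (nat \<Rightarrow> real) \<Rightarrow> nat \<Rightarrow> nat \<Rightarrow> (nat \<Rightarrow> real) \<Rightarrow> nat \<Rightarrow> real vec" where
  "noise_corr s u p q W n = vec (p + q) (\<lambda>k. \<Sum>i<n. psi s u p q i $ k * W i)"

lemma noise_corr_carrier [simp]: "noise_corr s u p q W n \<in> carrier_vec (p + q)"
  by (simp add: noise_corr_def)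

lemma scalar_prod_noise_corr:
  assumes "x \<in> carrier_vec (p + q)"
  shows "x \<bullet> noise_corr s u p q W n = (\<Sum>i<n. (x \<bullet> psi s u p q i) * W i)"
proof -
  have "x \<bullet> noise_corr s u p q W n = (\<Sum>j<p + q. \<Sum>i<n. x $ j * psi s u p q i $ j * W i)"
    by (simp add: noise_corr_def scalar_prod_eq_sum[of _ "p + q"] sum_distrib_left ac_simps)
  also have "\<dots> = (\<Sum>i<n. (x \<bullet> psi s u p q i) * W i)"
    by (subst sum.swap) (simp add: scalar_prod_eq_sum[of _ "p + q"] sum_distrib_right)
  finally show ?thesis .
qed

lemma vnorm_noise_corr_tendsto:
  assumes "\<And>k. k < p + q \<Longrightarrow> (\<lambda>n. (\<Sum>i<n. psi s u p q i $ k * W i) / real n) \<longlonglongrightarrow> 0"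
  shows "(\<lambda>n. vnorm (noise_corr s u p q W n) / real n) \<longlonglongrightarrow> 0"
proof -
  have "vnorm (noise_corr s u p q W n) / real n
        = sqrt (\<Sum>k<p + q. ((\<Sum>i<n. psi s u p q i $ k * W i) / real n)\<^sup>2)" for n
    by (simp add: vnorm_def noise_corr_def scalar_prod_eq_sum[of _ "p + q"] real_sqrt_divide
        power_divide flip: sum_divide_distrib power2_eq_square)
  moreover have "(\<lambda>n. sqrt (\<Sum>k<p + q. ((\<Sum>i<n. psi s u p q i $ k * W i) / real n)\<^sup>2))
      \<longlonglongrightarrow> sqrt (\<Sum>k<p + q. 0\<^sup>2)"
    by (intro tendsto_intros assms) auto
  ultimately show ?thesis by simp
qed

lemma eventually_le_linear:
  fixes f :: "nat \<Rightarrow> real"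
  assumes "(\<lambda>n. f n / real n) \<longlonglongrightarrow> 0" "\<kappa> > 0"
  shows "eventually (\<lambda>n. f n \<le> \<kappa> * real n) sequentially"
  using order_tendstoD(2)[OF assms] eventually_gt_at_top[of 0]
  by eventually_elim (simp add: field_simps)

lemma eventually_const_le_linear:
  fixes C :: real
  assumes "\<kappa> > 0"
  shows "eventually (\<lambda>n. C \<le> \<kappa> * real n) sequentially"
  using assms lim_const_over_n[of C] by (intro eventually_le_linear) auto

text \<open>One path at one order. \<open>d\<close> is merely bounded, while \<open>W\<close> is
  asymptotically uncorrelated with the regressors. It is instantiated at \<open>q0\<close> and at
  every larger admissible order.\<close>

locale perturbed_regression =
  fixes s u :: "nat \<Rightarrow> real" and p q :: nat and \<theta> :: "real vec" and d W :: "nat \<Rightarrow> real" and m :: real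
  assumes \<theta>: "\<theta> \<in> carrier_vec (p + q)"
    and decomp: "\<And>i. s (Suc i) = \<theta> \<bullet> psi s u p q i + d i + W i"
    and d_bound: "\<And>i. \<bar>d i\<bar> \<le> m"
    and noise: "(\<lambda>n. vnorm (noise_corr s u p q W n) / real n) \<longlonglongrightarrow> 0"
begin

text \<open>Depends on \<open>d\<close> and \<open>W\<close> only, so all orders share this
  reference value and their residual sums can be compared through it.\<close>

definition rss :: "nat \<Rightarrow> real" where "rss n = (\<Sum>i<n. (d i + W i)\<^sup>2)"

lemma m_nonneg: "0 \<le> m" using d_bound[of 0] by linarith

lemma sum_d_squared_le: "(\<Sum>i<n. (d i)\<^sup>2) \<le> m\<^sup>2 * real n"
proof -
  have "(d i)\<^sup>2 \<le> m\<^sup>2" for i using d_bound[of i] by (metis abs_ge_zero power2_abs power_mono)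
  then have "(\<Sum>i<n. (d i)\<^sup>2) \<le> (\<Sum>i<n. m\<^sup>2)" by (intro sum_mono)
  then show ?thesis by (simp add: mult.commute)
qed

lemma residual_sum_shift:
  assumes x: "x \<in> carrier_vec (p + q)"
  shows "(\<Sum>i<n. (s (Suc i) - (\<theta> + x) \<bullet> psi s u p q i)\<^sup>2)
         = rss n - 2 * (x \<bullet> noise_corr s u p q W n) - 2 * (\<Sum>i<n. d i * (x \<bullet> psi s u p q i))
           + (\<Sum>i<n. (x \<bullet> psi s u p q i)\<^sup>2)"
proof -
  have eq: "s (Suc i) - (\<theta> + x) \<bullet> psi s u p q i = d i + W i - x \<bullet> psi s u p q i" for i
    using x \<theta> by (simp add: decomp add_scalar_prod_distrib[of _ "p + q"])
  show ?thesis
    unfolding scalar_prod_noise_corr[OF x] rss_def eq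
    by (simp add: sum_subtractf[symmetric] sum_distrib_left sum.distrib[symmetric]
        power2_eq_square algebra_simps)
qed

lemma sigma_ls_upper: "sigma_ls s u p q n \<le> rss n + \<theta> \<bullet> \<theta>"
proof -
  have "(\<Sum>i<n. (s (Suc i) - \<theta> \<bullet> psi s u p q i)\<^sup>2) = rss n"
    by (simp add: decomp rss_def)
  then show ?thesis
    using theta_ls_minimises[OF \<theta>, of s u n] scalar_prod_self_nonneg[of "theta_ls s u p q n"]
    by simp
qed

text \<open>With x the estimation error, the residual sum is
  \<open>rss n - 2 * (x \<bullet> Z) - 2 * E + S\<close>. Completing the square gives
  \<open>2 * E - S \<le> m\<^sup>2 * real n\<close>. The noise term is small once x is bounded, and
  a large x is impossible: \<open>S\<close> would grow like \<open>c n\<close> times its squared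
  norm, contradicting \<open>sigma_ls_upper\<close>.\<close>

lemma sigma_ls_lower:
  assumes c: "c > 0"
    and ev: "eventually (\<lambda>n. \<forall>x \<in> carrier_vec (p + q).
               c * real n * (x \<bullet> x) \<le> x \<bullet> (Pinv s u p q n *\<^sub>v x)) sequentially"
    and \<kappa>: "\<kappa> > 0"
  shows "eventually (\<lambda>n. rss n - (m\<^sup>2 + \<kappa>) * real n \<le> sigma_ls s u p q n) sequentially"
proof -
  \<comment> \<open>Bound for the norm \<open>D\<close> of the error: if \<open>D > 1\<close>,
    dividing the inequality \<open>c / 2 * D\<^sup>2 \<le> 4 * D + 4 * m\<^sup>2 + 2\<close> by
    \<open>D\<close> leaves \<open>c / 2 * D \<le> 6 + 4 * m\<^sup>2\<close>.\<close>
  define K where "K = 1 + (12 + 8 * m\<^sup>2) / c"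
  have K: "K > 0" using c by (auto simp: K_def intro!: add_pos_nonneg)
  have noise_lin: "eventually (\<lambda>n. vnorm (noise_corr s u p q W n) \<le> t * real n) sequentially"
    if "t > 0" for t
    using eventually_le_linear[OF noise that] .
  have "0 < \<kappa> / (2 * K)" "0 < c / 2" "(0 :: real) < 1" using \<kappa> K c by auto
  show ?thesis
    using ev noise_lin[OF \<open>0 < 1\<close>] noise_lin[OF \<open>0 < \<kappa> / (2 * K)\<close>]
      eventually_const_le_linear[OF \<open>0 < 1\<close>, of "\<theta> \<bullet> \<theta>"]
      eventually_const_le_linear[OF \<open>0 < c / 2\<close>, of 1]
  proof eventually_elim
    case (elim n)
    define x where "x = theta_ls s u p q n - \<theta>"
    have x: "x \<in> carrier_vec (p + q)" using \<theta> by (simp add: x_def)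
    have eq: "theta_ls s u p q n = \<theta> + x"
      unfolding x_def using \<theta> theta_ls_carrier[of s u p q n] by (auto simp: vec_eq_iff)
    define Z where "Z = noise_corr s u p q W n"
    define S where "S = (\<Sum>i<n. (x \<bullet> psi s u p q i)\<^sup>2)"
    define E where "E = (\<Sum>i<n. d i * (x \<bullet> psi s u p q i))"
    define D where "D = vnorm x"
    have D: "D \<ge> 0" by (simp add: D_def)
    have \<sigma>: "sigma_ls s u p q n = rss n - 2 * (x \<bullet> Z) - 2 * E + S"
      unfolding sigma_ls_def eq residual_sum_shift[OF x] by (simp add: Z_def E_def S_def)
    have xZ: "\<bar>x \<bullet> Z\<bar> \<le> D * vnorm Z"
      unfolding D_def Z_def by (intro Cauchy_Schwarz_vnorm[OF x]) simp
    \<comment> \<open>Two ways to split the cross term: here only half of \<open>S\<close> is spent,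
      so that the other half can bound \<open>D\<close>; in \<open>E2\<close> all of
      \<open>S\<close> is spent, which gives the sharper constant.\<close>
    have E1: "2 * E \<le> 2 * m\<^sup>2 * real n + S / 2"
    proof -
      have "2 * (d i * t) \<le> 2 * (d i)\<^sup>2 + t\<^sup>2 / 2" for i t
        using zero_le_power2[of "2 * d i - t"] by (simp add: power2_eq_square algebra_simps)
      then have "2 * E \<le> (\<Sum>i<n. 2 * (d i)\<^sup>2 + (x \<bullet> psi s u p q i)\<^sup>2 / 2)"
        unfolding E_def sum_distrib_left by (intro sum_mono)
      also have "\<dots> = 2 * (\<Sum>i<n. (d i)\<^sup>2) + S / 2"
        by (simp add: S_def sum.distrib sum_distrib_left sum_divide_distrib)
      finally show ?thesis using sum_d_squared_le[of n] by simp
    qed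
    have E2: "2 * E - S \<le> m\<^sup>2 * real n"
    proof -
      have "2 * (d i * t) - t\<^sup>2 \<le> (d i)\<^sup>2" for i t
        using zero_le_power2[of "d i - t"] by (simp add: power2_eq_square algebra_simps)
      then have "2 * E - S \<le> (\<Sum>i<n. (d i)\<^sup>2)"
        unfolding E_def S_def sum_distrib_left sum_subtractf[symmetric] by (intro sum_mono)
      then show ?thesis using sum_d_squared_le[of n] by simp
    qed
    have "sigma_ls s u p q n \<le> rss n + \<theta> \<bullet> \<theta>" by (rule sigma_ls_upper)
    then have "S \<le> 4 * (x \<bullet> Z) + 4 * m\<^sup>2 * real n + 2 * (\<theta> \<bullet> \<theta>)"
      using \<sigma> E1 by simp
    moreover have "c * real n * D\<^sup>2 \<le> D\<^sup>2 + S"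
      using bspec[OF elim(1) x] scalar_prod_Pinv[OF x x, of s u n]
      unfolding D_def vnorm_squared S_def by (simp add: power2_eq_square)
    \<comment> \<open>For large n the identity summand of \<open>Pinv\<close> is absorbed by half of
      the quadratic growth.\<close>
    moreover have "D\<^sup>2 \<le> c / 2 * real n * D\<^sup>2"
      using mult_right_mono[OF elim(5), of "D\<^sup>2"] by simp
    moreover have "x \<bullet> Z \<le> D * real n"
      using xZ mult_left_mono[OF elim(2) D] by (simp add: Z_def)
    ultimately have "c / 2 * real n * D\<^sup>2 \<le> 4 * (D * real n) + 4 * m\<^sup>2 * real n + 2 * real n"
      using elim(4) by simp
    then have quad: "(c / 2 * D\<^sup>2) * real n \<le> (4 * D + 4 * m\<^sup>2 + 2) * real n"
      by (simp add: algebra_simps)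
    have "n > 0" using elim(5) by (cases n) auto
    have quad: "c / 2 * D\<^sup>2 \<le> 4 * D + 4 * m\<^sup>2 + 2"
      using quad \<open>n > 0\<close> by (metis mult_le_cancel_right_pos of_nat_0_less_iff)
    have DK: "D \<le> K"
    proof (cases "D \<le> 1")
      case True
      then show ?thesis using c by (auto simp: K_def intro!: add_increasing2)
    next
      case False
      then have "4 * m\<^sup>2 * 1 + 2 * 1 \<le> 4 * m\<^sup>2 * D + 2 * D"
        by (intro add_mono mult_left_mono) auto
      then have "(c / 2 * D) * D \<le> (6 + 4 * m\<^sup>2) * D"
        using quad by (simp add: power2_eq_square algebra_simps)
      then have "c / 2 * D \<le> 6 + 4 * m\<^sup>2" using False by simp
      then have "D \<le> (12 + 8 * m\<^sup>2) / c" using c by (simp add: field_simps)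
      then show ?thesis by (simp add: K_def)
    qed
    have "2 * (x \<bullet> Z) \<le> 2 * (K * vnorm Z)"
      using xZ mult_right_mono[OF DK, of "vnorm Z"] by simp
    also have "\<dots> \<le> 2 * (K * (\<kappa> / (2 * K) * real n))"
      using elim(3) K by (intro mult_left_mono) (auto simp: Z_def)
    also have "\<dots> = \<kappa> * real n" using K by simp
    finally show ?case using \<sigma> E2 by (simp add: algebra_simps)
  qed
qed

text \<open>Meant for a parameter error that stays away from 0: then \<open>S\<close> is at least
  about \<open>\<beta>\<^sup>2 * c * real n\<close>. Since \<open>S\<close> is also at most
  \<open>C * real n * \<gamma>\<^sup>2\<close>, Cauchy-Schwarz bounds the cross term with
  \<open>d\<close> by \<open>\<gamma> * m * sqrt C * real n\<close>.\<close>

lemma residual_sum_lower: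
  fixes x :: "nat \<Rightarrow> real vec"
  assumes c: "c > 0" and C: "C > 0"
    and ev: "eventually (\<lambda>n. \<forall>x \<in> carrier_vec (p + q).
               c * real n * (x \<bullet> x) \<le> x \<bullet> (Pinv s u p q n *\<^sub>v x)) sequentially"
    and ev': "eventually (\<lambda>n. \<forall>x \<in> carrier_vec (p + q).
               x \<bullet> (Pinv s u p q n *\<^sub>v x) \<le> C * real n * (x \<bullet> x)) sequentially"
    and x: "\<And>n. x n \<in> carrier_vec (p + q)" and x_low: "\<And>n. \<beta>\<^sup>2 \<le> x n \<bullet> x n"
    and x_up: "eventually (\<lambda>n. vnorm (x n) \<le> \<gamma>) sequentially"
    and \<kappa>: "\<kappa> > 0"
  shows "eventually (\<lambda>n. rss n + (\<beta>\<^sup>2 * c - 2 * \<gamma> * m * sqrt C - \<kappa>) * real n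
           \<le> (\<Sum>i<n. (s (Suc i) - (\<theta> - x n) \<bullet> psi s u p q i)\<^sup>2)) sequentially"
proof -
  obtain n0 where "vnorm (x n0) \<le> \<gamma>"
    using eventually_happens'[OF sequentially_bot x_up] by blast
  then have \<gamma>: "\<gamma> \<ge> 0" using vnorm_nonneg order_trans by blast
  \<comment> \<open>Dividing by \<gamma> + 1 covers the case \<gamma> = 0.\<close>
  have "0 < \<kappa> / (4 * (\<gamma> + 1))" "0 < \<kappa> / 2" using \<kappa> \<gamma> by auto
  show ?thesis
    using ev ev' x_up eventually_le_linear[OF noise \<open>0 < \<kappa> / (4 * (\<gamma> + 1))\<close>]
      eventually_const_le_linear[OF \<open>0 < \<kappa> / 2\<close>, of "\<beta>\<^sup>2"] eventually_const_le_linear[OF c, of 1]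
  proof eventually_elim
    case (elim n)
    define Z where "Z = noise_corr s u p q W n"
    define S where "S = (\<Sum>i<n. (x n \<bullet> psi s u p q i)\<^sup>2)"
    define E where "E = (\<Sum>i<n. d i * (x n \<bullet> psi s u p q i))"
    have mx: "- x n \<in> carrier_vec (p + q)" "\<theta> - x n = \<theta> + - x n"
      using x[of n] \<theta> by (auto simp: vec_eq_iff)
    have \<psi>: "(- x n) \<bullet> psi s u p q i = - (x n \<bullet> psi s u p q i)" for i
      using x[of n] by (simp add: uminus_scalar_prod[of _ "p + q"])
    have Zx: "(- x n) \<bullet> Z = - (x n \<bullet> Z)"
      using x[of n] by (simp add: Z_def uminus_scalar_prod[of _ "p + q"])
    have res: "(\<Sum>i<n. (s (Suc i) - (\<theta> - x n) \<bullet> psi s u p q i)\<^sup>2) = rss n + 2 * (x n \<bullet> Z) + 2 * E + S"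
      unfolding mx(2) residual_sum_shift[OF mx(1)]
      using Zx by (simp add: \<psi> Z_def E_def S_def sum_negf)
    have PS: "x n \<bullet> (Pinv s u p q n *\<^sub>v x n) = x n \<bullet> x n + S"
      by (simp add: scalar_prod_Pinv x S_def power2_eq_square)
    \<comment> \<open>The \<open>- 1\<close> takes away the identity summand of \<open>Pinv\<close>,
      leaving \<open>S\<close> alone.\<close>
    have "(c * real n - 1) * \<beta>\<^sup>2 \<le> (c * real n - 1) * (x n \<bullet> x n)"
      using x_low elim(6) by (intro mult_left_mono) auto
    also have "\<dots> \<le> S" using bspec[OF elim(1) x[of n]] PS by (simp add: algebra_simps)
    finally have S_low: "\<beta>\<^sup>2 * c * real n - \<kappa> / 2 * real n \<le> S"
      using elim(5) by (simp add: algebra_simps)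
    have xx: "x n \<bullet> x n \<le> \<gamma>\<^sup>2"
      using elim(3) by (metis vnorm_squared vnorm_nonneg power_mono)
    have "S \<le> C * real n * (x n \<bullet> x n)"
      using bspec[OF elim(2) x[of n]] PS scalar_prod_self_nonneg[of "x n"] by simp
    also have "\<dots> \<le> C * real n * \<gamma>\<^sup>2" using xx C by (intro mult_left_mono) auto
    finally have S_up: "S \<le> C * real n * \<gamma>\<^sup>2" .
    have "E\<^sup>2 \<le> (\<Sum>i<n. (d i)\<^sup>2) * S"
      unfolding E_def S_def by (rule Cauchy_Schwarz_ineq_sum)
    also have "\<dots> \<le> (m\<^sup>2 * real n) * (C * real n * \<gamma>\<^sup>2)"
      using sum_d_squared_le S_up C by (intro mult_mono) (auto simp: S_def sum_nonneg)
    also have "\<dots> = (\<gamma> * m * sqrt C * real n)\<^sup>2"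
      using C by (simp add: power2_eq_square algebra_simps)
    finally have "\<bar>E\<bar> \<le> \<gamma> * m * sqrt C * real n"
      using \<gamma> m_nonneg C by (simp add: abs_le_square_iff[symmetric])
    moreover have "\<bar>x n \<bullet> Z\<bar> \<le> \<kappa> / 4 * real n"
    proof -
      have "\<bar>x n \<bullet> Z\<bar> \<le> vnorm (x n) * vnorm Z"
        unfolding Z_def by (intro Cauchy_Schwarz_vnorm[OF x]) simp
      also have "\<dots> \<le> (\<gamma> + 1) * (\<kappa> / (4 * (\<gamma> + 1)) * real n)"
        using elim(3,4) \<gamma> by (intro mult_mono) (auto simp: Z_def)
      also have "\<dots> = \<kappa> / 4 * real n" using \<gamma> by (simp add: field_simps)
      finally show ?thesis .
    qed
    ultimately have "rss n + \<beta>\<^sup>2 * c * real n - 2 * (\<gamma> * m * sqrt C * real n) - \<kappa> * real n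
        \<le> (\<Sum>i<n. (s (Suc i) - (\<theta> - x n) \<bullet> psi s u p q i)\<^sup>2)"
      using res S_low by linarith
    then show ?case by (simp add: algebra_simps)
  qed
qed

end

text \<open>\<open>lam_min\<close> at n is built from \<open>Pinv\<close> at \<open>Suc n\<close>,
  so the bound with \<open>real n + 1\<close> becomes one with \<open>real n\<close> after an index
  shift. The dimension must be positive for the spectrum to be nonempty.\<close>

lemma Pinv_lower:
  assumes "0 < p + q"
    and "eventually (\<lambda>n. c * (real n + 1) \<le> lam_min s u p q n) sequentially"
  shows "eventually (\<lambda>n. \<forall>x \<in> carrier_vec (p + q).
           c * real n * (x \<bullet> x) \<le> x \<bullet> (Pinv s u p q n *\<^sub>v x)) sequentially"
proof -
  have "eventually (\<lambda>n. \<forall>x \<in> carrier_vec (p + q).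
           c * real (Suc n) * (x \<bullet> x) \<le> x \<bullet> (Pinv s u p q (Suc n) *\<^sub>v x)) sequentially"
    using assms(2)
  proof eventually_elim
    case (elim n)
    show ?case
    proof
      fix x :: "real vec" assume x: "x \<in> carrier_vec (p + q)"
      have "c * real (Suc n) * (x \<bullet> x) \<le> lam_min s u p q n * (x \<bullet> x)"
        using elim by (intro mult_right_mono scalar_prod_self_nonneg) (simp add: add.commute)
      also have "\<dots> \<le> x \<bullet> (Pinv s u p q (Suc n) *\<^sub>v x)"
        unfolding lam_min_def
        by (rule Min_eigenvalue_rayleigh[OF Pinv_carrier transpose_Pinv assms(1) x])
      finally show "c * real (Suc n) * (x \<bullet> x) \<le> x \<bullet> (Pinv s u p q (Suc n) *\<^sub>v x)" .
    qed
  qed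
  then show ?thesis by (subst (asm) eventually_sequentially_Suc)
qed

lemma Pinv_upper:
  assumes "0 < p + q"
    and "eventually (\<lambda>n. lam_max s u p q n \<le> C * (real n + 1)) sequentially"
  shows "eventually (\<lambda>n. \<forall>x \<in> carrier_vec (p + q).
           x \<bullet> (Pinv s u p q n *\<^sub>v x) \<le> C * real n * (x \<bullet> x)) sequentially"
proof -
  have "eventually (\<lambda>n. \<forall>x \<in> carrier_vec (p + q).
           x \<bullet> (Pinv s u p q (Suc n) *\<^sub>v x) \<le> C * real (Suc n) * (x \<bullet> x)) sequentially"
    using assms(2)
  proof eventually_elim
    case (elim n)
    show ?case
    proof
      fix x :: "real vec" assume x: "x \<in> carrier_vec (p + q)"
      have "x \<bullet> (Pinv s u p q (Suc n) *\<^sub>v x) \<le> lam_max s u p q n * (x \<bullet> x)"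
        unfolding lam_max_def
        by (rule Max_eigenvalue_rayleigh[OF Pinv_carrier transpose_Pinv assms(1) x])
      also have "\<dots> \<le> C * real (Suc n) * (x \<bullet> x)"
        using elim by (intro mult_right_mono scalar_prod_self_nonneg) (simp add: add.commute)
      finally show "x \<bullet> (Pinv s u p q (Suc n) *\<^sub>v x) \<le> C * real (Suc n) * (x \<bullet> x)" .
    qed
  qed
  then show ?thesis by (subst (asm) eventually_sequentially_Suc)
qed

section \<open>Nested orders and the comparison of the criteria\<close>

lemma psi_index_mono: "k < p + q \<Longrightarrow> q \<le> q' \<Longrightarrow> psi s u p q i $ k = psi s u p q' i $ k"
  by (simp add: psi_def)

text \<open>The inputs form the last block of the regressor, so raising \<open>q\<close> only
  appends coordinates, and a zero-padded parameter predicts the same values.\<close>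

lemma scalar_prod_psi_extend:
  assumes "q \<le> q'" "x \<in> carrier_vec (p + q)"
  shows "vec (p + q') (\<lambda>k. if k < p + q then x $ k else 0) \<bullet> psi s u p q' i = x \<bullet> psi s u p q i"
proof -
  have "vec (p + q') (\<lambda>k. if k < p + q then x $ k else 0) \<bullet> psi s u p q' i
        = (\<Sum>k<p + q'. if k < p + q then x $ k * psi s u p q i $ k else 0)"
    using assms(1) by (auto simp: scalar_prod_eq_sum[of _ "p + q'"] psi_index_mono[of _ p q q'] intro!: sum.cong)
  also have "\<dots> = (\<Sum>k<p + q. x $ k * psi s u p q i $ k)"
    using assms(1) by (intro sum.mono_neutral_cong_right) auto
  also have "\<dots> = x \<bullet> psi s u p q i" by (simp add: scalar_prod_eq_sum[of _ "p + q"])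
  finally show ?thesis .
qed

lemma theta_bar_carrier [simp]: "theta_bar a b p0 q0 p q \<in> carrier_vec (p + q)"
  by (simp add: theta_bar_def)

text \<open>Lets the decomposition of the output at order \<open>q0\<close> serve at every larger
  order with the same \<open>d\<close> and \<open>W\<close>.\<close>

lemma theta_bar_scalar_prod_psi:
  assumes "q0 \<le> q"
  shows "theta_bar a b p0 q0 p q \<bullet> psi s u p q i = theta_bar a b p0 q0 p q0 \<bullet> psi s u p q0 i"
proof -
  have "theta_bar a b p0 q0 p q
        = vec (p + q) (\<lambda>k. if k < p + q0 then theta_bar a b p0 q0 p q0 $ k else 0)"
    using assms by (auto simp: theta_bar_def vec_eq_iff)
  then show ?thesis using scalar_prod_psi_extend[OF assms] by simp
qed

text \<open>Overfitting (\<open>q > q0\<close>) lowers the residual sum by at most \<open>m\<^sup>2 n + o(n)\<close>, less than one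
  penalty step; underfitting (\<open>q < q0\<close>) misses the coefficient \<open>b q0\<close> and raises it by more than
  the total penalty saved.\<close>

lemma arg_min_Vcrit_eventually:
  fixes s u d W v a b :: "nat \<Rightarrow> real" and pstar qstar p0 q0 :: nat
  defines "\<theta> \<equiv> theta_bar a b p0 q0 pstar q0"
  assumes q0: "1 \<le> q0" "q0 \<le> qstar" and pstar: "0 < pstar"
    and decomp: "\<And>i. s (Suc i) = \<theta> \<bullet> psi s u pstar q0 i + d i + W i"
    and d_bound: "\<And>i. \<bar>d i\<bar> \<le> m" and m: "m\<^sup>2 \<le> \<eta>" "0 < \<eta>"
    and noise: "\<And>k. k < pstar + qstar \<Longrightarrow>
         (\<lambda>n. (\<Sum>i<n. psi s u pstar qstar i $ k * W i) / real n) \<longlonglongrightarrow> 0"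
    and c2: "0 < c2" and c4: "0 < c4"
    and lmin: "\<And>q. q \<le> qstar \<Longrightarrow>
         eventually (\<lambda>n. c2 * (real n + 1) \<le> lam_min s u pstar q n) sequentially"
    and lmax: "eventually (\<lambda>n. lam_max s u pstar q0 n \<le> c4 * (real n + 1)) sequentially"
    and gam: "eventually (\<lambda>n. \<forall>q \<le> q0. vnorm (theta_tilde a b p0 q0 s u pstar q n) \<le> \<gamma>) sequentially"
    and \<beta>1: "0 < \<beta>1" and \<beta>2: "0 < \<beta>2" "\<beta>2 < 1"
    and v_low: "\<And>n. (5 * \<eta> + \<beta>1) * real n \<le> v n"
    and v_up: "\<And>n. v n \<le> \<beta>2 / real qstar * ((b q0)\<^sup>2 * c2 - 2 * \<gamma> * sqrt (c4 * \<eta>) - 3 * \<eta>) * real n"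
  shows "eventually (\<lambda>n. arg_min (Vcrit v s u n pstar) (\<lambda>q. q \<le> qstar) = q0) sequentially"
proof -
  define U where "U = (b q0)\<^sup>2 * c2 - 2 * \<gamma> * sqrt (c4 * \<eta>) - 3 * \<eta>"
  have \<theta>c: "\<theta> \<in> carrier_vec (pstar + q0)" by (simp add: \<theta>_def)
  have reg: "perturbed_regression s u pstar q (theta_bar a b p0 q0 pstar q) d W m"
    if q: "q0 \<le> q" "q \<le> qstar" for q
  proof
    show "s (Suc i) = theta_bar a b p0 q0 pstar q \<bullet> psi s u pstar q i + d i + W i" for i
      using decomp[of i] theta_bar_scalar_prod_psi[OF q(1)] by (simp add: \<theta>_def)
    show "(\<lambda>n. vnorm (noise_corr s u pstar q W n) / real n) \<longlonglongrightarrow> 0"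
      using noise q by (intro vnorm_noise_corr_tendsto) (simp add: psi_index_mono[of _ _ q qstar])
  qed (use d_bound in auto)
  interpret R: perturbed_regression s u pstar q0 \<theta> d W m
    using reg[of q0] q0 by (simp add: \<theta>_def)
  have lmin': "eventually (\<lambda>n. \<forall>x \<in> carrier_vec (pstar + q).
           c2 * real n * (x \<bullet> x) \<le> x \<bullet> (Pinv s u pstar q n *\<^sub>v x)) sequentially" if "q \<le> qstar" for q
    using that pstar by (intro Pinv_lower lmin) auto
  have lmax': "eventually (\<lambda>n. \<forall>x \<in> carrier_vec (pstar + q0).
           x \<bullet> (Pinv s u pstar q0 n *\<^sub>v x) \<le> c4 * real n * (x \<bullet> x)) sequentially"
    using pstar by (intro Pinv_upper lmax) auto
  have qs: "0 < real qstar" using q0 by simp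
  \<comment> \<open>The two bounds on \<open>v 1\<close> are compatible only if the upper slope is
    positive.\<close>
  have U: "U > 0"
  proof -
    have "0 < 5 * \<eta> + \<beta>1" using m \<beta>1 by simp
    also have "\<dots> \<le> \<beta>2 / real qstar * U" using v_low[of 1] v_up[of 1] by (simp add: U_def)
    finally show ?thesis using \<beta>2 qs by (simp add: zero_less_mult_iff zero_less_divide_iff)
  qed
  obtain n0 where "vnorm (theta_tilde a b p0 q0 s u pstar q0 n0) \<le> \<gamma>"
    using eventually_happens'[OF sequentially_bot gam] by blast
  then have \<gamma>: "\<gamma> \<ge> 0" using vnorm_nonneg order_trans by blast
  have over: "eventually (\<lambda>n. Vcrit v s u n pstar q0 < Vcrit v s u n pstar q) sequentially"
    if q: "q0 < q" "q \<le> qstar" for q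
  proof -
    interpret Q: perturbed_regression s u pstar q "theta_bar a b p0 q0 pstar q" d W m
      using reg[of q] q by simp
    \<comment> \<open>Budget for \<beta>1 n: one half is the tolerance in
      \<open>sigma_ls_lower\<close>, one quarter absorbs \<open>\<theta> \<bullet> \<theta>\<close>,
      and the last quarter makes the comparison strict.\<close>
    have pos: "0 < \<beta>1 / 4" using \<beta>1 by simp
    have "eventually (\<lambda>n. Q.rss n - (m\<^sup>2 + \<beta>1 / 2) * real n \<le> sigma_ls s u pstar q n) sequentially"
      using q \<beta>1 by (intro Q.sigma_ls_lower[OF c2 lmin']) auto
    then show ?thesis
      using eventually_const_le_linear[OF pos, of "\<theta> \<bullet> \<theta>"] eventually_gt_at_top[of 0]
    proof eventually_elim
      case (elim n)
      have vn: "0 \<le> v n" using v_low[of n] m \<beta>1 by (meson add_nonneg_nonneg less_imp_le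
            mult_nonneg_nonneg of_nat_0_le_iff order_trans zero_le_numeral)
      have "m\<^sup>2 * real n \<le> 5 * \<eta> * real n" using m by (intro mult_right_mono) auto
      moreover have "0 < \<beta>1 * real n" using elim \<beta>1 by simp
      moreover have "sigma_ls s u pstar q0 n \<le> R.rss n + \<theta> \<bullet> \<theta>" by (rule R.sigma_ls_upper)
      moreover have "R.rss n - m\<^sup>2 * real n - \<beta>1 / 2 * real n \<le> sigma_ls s u pstar q n"
        using elim(1) by (simp add: algebra_simps)
      moreover have "5 * \<eta> * real n + \<beta>1 * real n \<le> v n"
        using v_low[of n] by (simp add: algebra_simps)
      ultimately have "sigma_ls s u pstar q0 n < sigma_ls s u pstar q n + v n"
        using elim(2) by linarith
      also have "\<dots> \<le> sigma_ls s u pstar q n + v n * real (q - q0)"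
        using q vn mult_left_mono[of 1 "real (q - q0)" "v n"] by simp
      finally show ?case using q by (simp add: Vcrit_def algebra_simps of_nat_diff)
    qed
  qed
  have under: "eventually (\<lambda>n. Vcrit v s u n pstar q0 < Vcrit v s u n pstar q) sequentially"
    if q: "q < q0" for q
  proof -
    define x where "x = theta_tilde a b p0 q0 s u pstar q"
    \<comment> \<open>Chosen so that \<open>\<beta>2 * U = U - 2 * \<kappa>\<close>: one \<kappa> is
      the tolerance in \<open>residual_sum_lower\<close>, half of the other absorbs
      \<open>\<theta> \<bullet> \<theta>\<close>, and the rest gives strictness.\<close>
    define \<kappa> where "\<kappa> = (1 - \<beta>2) * U / 2"
    have \<kappa>: "\<kappa> > 0" using U \<beta>2 by (simp add: \<kappa>_def)
    have hat: "theta_hat s u pstar q0 q n \<in> carrier_vec (pstar + q0)" for n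
      by (simp add: theta_hat_def)
    have x: "x n \<in> carrier_vec (pstar + q0)" for n
      using hat[of n] by (simp add: x_def theta_tilde_def)
    have \<theta>x: "\<theta> - x n = theta_hat s u pstar q0 q n" for n
      using hat[of n] unfolding x_def theta_tilde_def \<theta>_def by (auto simp: vec_eq_iff theta_bar_def)
    have \<sigma>: "(\<Sum>i<n. (s (Suc i) - (\<theta> - x n) \<bullet> psi s u pstar q0 i)\<^sup>2) = sigma_ls s u pstar q n" for n
      using q unfolding \<theta>x theta_hat_def sigma_ls_def
      by (simp add: scalar_prod_psi_extend)
    have x_low: "(b q0)\<^sup>2 \<le> x n \<bullet> x n" for n
    proof -
      \<comment> \<open>The last coordinate belongs to the largest input lag, where the estimate of
        order \<open>q < q0\<close> is padded by 0.\<close>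
      have "x n $ (pstar + q0 - 1) = b q0"
        using q q0 by (cases q0) (auto simp: x_def theta_tilde_def theta_bar_def theta_hat_def)
      then have "(b q0)\<^sup>2 = (x n $ (pstar + q0 - 1))\<^sup>2" by simp
      also have "\<dots> \<le> (\<Sum>k<pstar + q0. (x n $ k)\<^sup>2)"
        using q0 by (intro member_le_sum) auto
      finally show ?thesis using x[of n]
        by (simp add: scalar_prod_eq_sum[of _ "pstar + q0"] power2_eq_square)
    qed
    have x_up: "eventually (\<lambda>n. vnorm (x n) \<le> \<gamma>) sequentially"
      using gam q by (auto elim!: eventually_mono simp: x_def)
    \<comment> \<open>Converts the Cauchy-Schwarz loss into the square root occurring in the upper
      bound on \<open>v\<close>.\<close>
    have "m * sqrt c4 \<le> sqrt (c4 * \<eta>)"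
      using m R.m_nonneg c4 by (intro real_le_rsqrt) (simp add: power_mult_distrib mult.commute)
    then have "2 * \<gamma> * (m * sqrt c4) \<le> 2 * \<gamma> * sqrt (c4 * \<eta>)"
      using \<gamma> by (intro mult_left_mono) auto
    then have U_le: "U \<le> (b q0)\<^sup>2 * c2 - 2 * \<gamma> * m * sqrt c4"
      using m by (simp add: U_def)
    have pos: "0 < \<kappa> / 2" using \<kappa> by simp
    have "eventually (\<lambda>n. R.rss n + ((b q0)\<^sup>2 * c2 - 2 * \<gamma> * m * sqrt c4 - \<kappa>) * real n
           \<le> sigma_ls s u pstar q n) sequentially"
      using R.residual_sum_lower[OF c2 c4 lmin'[OF q0(2)] lmax' x x_low x_up \<kappa>] by (simp add: \<sigma>)
    then show ?thesis
      using eventually_const_le_linear[OF pos, of "\<theta> \<bullet> \<theta>"] eventually_gt_at_top[of 0]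
    proof eventually_elim
      case (elim n)
      have vn: "0 \<le> v n" using v_low[of n] m \<beta>1 by (meson add_nonneg_nonneg less_imp_le
            mult_nonneg_nonneg of_nat_0_le_iff order_trans zero_le_numeral)
      \<comment> \<open>At most \<open>qstar\<close> penalty steps are saved, which cancels the
        factor \<open>1 / real qstar\<close> in the upper bound.\<close>
      have "v n * real (q0 - q) \<le> v n * real qstar"
        using q0 vn by (intro mult_left_mono) auto
      also have "\<dots> \<le> \<beta>2 * U * real n"
        using mult_right_mono[OF v_up[of n], of "real qstar"] qs by (simp add: U_def)
      also have "\<dots> = U * real n - 2 * \<kappa> * real n" by (simp add: \<kappa>_def field_simps)
      finally have A: "v n * real (q0 - q) \<le> U * real n - 2 * \<kappa> * real n" .
      have "(U - \<kappa>) * real n \<le> ((b q0)\<^sup>2 * c2 - 2 * \<gamma> * m * sqrt c4 - \<kappa>) * real n"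
        by (rule mult_right_mono) (use U_le in simp_all)
      then have "R.rss n + U * real n - \<kappa> * real n \<le> sigma_ls s u pstar q n"
        using elim(1) by (simp only: left_diff_distrib)
      moreover have "sigma_ls s u pstar q0 n \<le> R.rss n + \<theta> \<bullet> \<theta>" by (rule R.sigma_ls_upper)
      moreover have "0 < \<kappa> * real n" using elim \<kappa> by simp
      ultimately have "sigma_ls s u pstar q0 n + v n * real (q0 - q) < sigma_ls s u pstar q n"
        using elim(2) A by linarith
      then show ?case using q by (simp add: Vcrit_def algebra_simps of_nat_diff)
    qed
  qed
  have "eventually (\<lambda>n. Vcrit v s u n pstar q0 < Vcrit v s u n pstar q) sequentially"
    if "q \<in> {..qstar} - {q0}" for q
    using that over[of q] under[of q] by (cases "q < q0") auto
  then have "eventually (\<lambda>n. \<forall>q \<in> {..qstar} - {q0}.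
          Vcrit v s u n pstar q0 < Vcrit v s u n pstar q) sequentially"
    by (intro eventually_ball_finite) auto
  then show ?thesis
  proof eventually_elim
    case (elim n)
    have less: "Vcrit v s u n pstar q0 < Vcrit v s u n pstar q" if "q \<le> qstar" "q \<noteq> q0" for q
      using elim that by blast
    \<comment> \<open>Strict inequalities make the minimiser unique, so the choice operator behind
      \<open>arg_min\<close> is determined.\<close>
    have "is_arg_min (Vcrit v s u n pstar) (\<lambda>q. q \<le> qstar) q \<longleftrightarrow> q = q0" for q
      unfolding is_arg_min_def using less q0(2) by (metis less_asym)
    then show ?case by (auto simp: arg_min_def intro!: some_equality)
  qed
qed

section \<open>A strong law for uncorrelated variables\<close>

text \<open>The series of the variables has finite expectation by monotone convergence, hence is
  almost surely finite, and its terms tend to 0.\<close>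

lemma AE_tendsto_zero_of_summable_expectation:
  fixes X :: "nat \<Rightarrow> 'a \<Rightarrow> real"
  assumes int: "\<And>k. integrable M (X k)" and nn: "\<And>k \<omega>. 0 \<le> X k \<omega>"
    and sum: "summable (\<lambda>k. \<integral>\<omega>. X k \<omega> \<partial>M)"
  shows "AE \<omega> in M. (\<lambda>k. X k \<omega>) \<longlonglongrightarrow> 0"
proof -
  have [measurable]: "X k \<in> borel_measurable M" for k using int by auto
  have E: "0 \<le> (\<integral>\<omega>. X k \<omega> \<partial>M)" for k by (intro integral_nonneg_AE) (simp add: nn)
  have "(\<integral>\<^sup>+\<omega>. (\<Sum>k. ennreal (X k \<omega>)) \<partial>M) = (\<Sum>k. \<integral>\<^sup>+\<omega>. ennreal (X k \<omega>) \<partial>M)"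
    by (intro nn_integral_suminf) auto
  also have "\<dots> = (\<Sum>k. ennreal (\<integral>\<omega>. X k \<omega> \<partial>M))"
    by (intro suminf_cong nn_integral_eq_integral int) (simp add: nn)
  also have "\<dots> = ennreal (\<Sum>k. \<integral>\<omega>. X k \<omega> \<partial>M)"
    by (rule suminf_ennreal2[OF E sum])
  finally have "(\<integral>\<^sup>+\<omega>. (\<Sum>k. ennreal (X k \<omega>)) \<partial>M) \<noteq> \<infinity>" by simp
  then have "AE \<omega> in M. (\<Sum>k. ennreal (X k \<omega>)) \<noteq> \<infinity>"
    by (intro nn_integral_noteq_infinite) auto
  then show ?thesis
  proof eventually_elim
    case (elim \<omega>)
    then have "summable (\<lambda>k. X k \<omega>)" using nn by (intro summable_suminf_not_top) auto
    then show ?case by (rule summable_LIMSEQ_zero)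
  qed
qed

lemma integrable_mult_of_squares:
  fixes X Y :: "'a \<Rightarrow> real"
  assumes [measurable]: "X \<in> borel_measurable M" "Y \<in> borel_measurable M"
    and "integrable M (\<lambda>\<omega>. (X \<omega>)\<^sup>2)" "integrable M (\<lambda>\<omega>. (Y \<omega>)\<^sup>2)"
  shows "integrable M (\<lambda>\<omega>. X \<omega> * Y \<omega>)"
proof (rule Bochner_Integration.integrable_bound)
  show "integrable M (\<lambda>\<omega>. (X \<omega>)\<^sup>2 + (Y \<omega>)\<^sup>2)" using assms by auto
  have "\<bar>x * y\<bar> \<le> x\<^sup>2 + y\<^sup>2" for x y :: real
    using sum_squares_bound[of "\<bar>x\<bar>" "\<bar>y\<bar>"] abs_ge_zero[of "x * y"]
    unfolding abs_mult power2_abs by linarith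
  then show "AE \<omega> in M. norm (X \<omega> * Y \<omega>) \<le> norm ((X \<omega>)\<^sup>2 + (Y \<omega>)\<^sup>2)"
    by simp
qed simp

text \<open>Chebyshev along the squares \<open>k\<^sup>2\<close>; between consecutive squares there are only \<open>2 k + 1\<close>
  terms, whose absolute sum is controlled by Cauchy-Schwarz.\<close>

lemma slln_uncorrelated:
  fixes D :: "nat \<Rightarrow> 'a \<Rightarrow> real"
  assumes meas [measurable]: "\<And>i. D i \<in> borel_measurable M"
    and int: "\<And>i. integrable M (\<lambda>\<omega>. (D i \<omega>)\<^sup>2)"
    and bound: "\<And>i. (\<integral>\<omega>. (D i \<omega>)\<^sup>2 \<partial>M) \<le> C"
    and orth: "\<And>i j. i < j \<Longrightarrow> (\<integral>\<omega>. D i \<omega> * D j \<omega> \<partial>M) = 0"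
  shows "AE \<omega> in M. (\<lambda>n. (\<Sum>i<n. D i \<omega>) / real n) \<longlonglongrightarrow> 0"
proof -
  define S where "S n \<omega> = (\<Sum>i<n. D i \<omega>)" for n \<omega>
  define T where "T k \<omega> = (\<Sum>i\<in>{k\<^sup>2..<(Suc k)\<^sup>2}. \<bar>D i \<omega>\<bar>)" for k \<omega>
  have [measurable]: "S n \<in> borel_measurable M" "T n \<in> borel_measurable M" for n
    by (simp_all add: S_def[abs_def] T_def[abs_def])
  have DD: "integrable M (\<lambda>\<omega>. D i \<omega> * D j \<omega>)" for i j
    by (intro integrable_mult_of_squares int) auto
  have "0 \<le> (\<integral>\<omega>. (D 0 \<omega>)\<^sup>2 \<partial>M)" by (rule integral_nonneg_AE) simp
  then have C: "0 \<le> C" using bound[of 0] by linarith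
  \<comment> \<open>Orthogonality makes second moments additive, so they grow linearly; at
    \<open>k\<^sup>2\<close>, after division by \<open>k ^ 4\<close>, they are of order
    \<open>1 / k\<^sup>2\<close>.\<close>
  have S2: "integrable M (\<lambda>\<omega>. (S n \<omega>)\<^sup>2) \<and> (\<integral>\<omega>. (S n \<omega>)\<^sup>2 \<partial>M) \<le> C * real n" for n
  proof (induction n)
    case 0 then show ?case by (simp add: S_def)
  next
    case (Suc n)
    have eq: "(S (Suc n) \<omega>)\<^sup>2 = (S n \<omega>)\<^sup>2 + 2 * (\<Sum>i<n. D i \<omega> * D n \<omega>) + (D n \<omega>)\<^sup>2" for \<omega>
      by (simp add: S_def power2_eq_square algebra_simps sum_distrib_left)
    have "(\<integral>\<omega>. (\<Sum>i<n. D i \<omega> * D n \<omega>) \<partial>M) = 0"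
      by (subst Bochner_Integration.integral_sum) (auto simp: DD orth)
    then have "(\<integral>\<omega>. (S (Suc n) \<omega>)\<^sup>2 \<partial>M) = (\<integral>\<omega>. (S n \<omega>)\<^sup>2 \<partial>M) + (\<integral>\<omega>. (D n \<omega>)\<^sup>2 \<partial>M)"
      unfolding eq using Suc int DD by simp
    moreover have "integrable M (\<lambda>\<omega>. (S (Suc n) \<omega>)\<^sup>2)"
      unfolding eq using Suc int DD by simp
    ultimately show ?case using Suc bound[of n] by (simp add: algebra_simps)
  qed
  have T_le: "(T k \<omega>)\<^sup>2 \<le> real (2 * k + 1) * (\<Sum>i\<in>{k\<^sup>2..<(Suc k)\<^sup>2}. (D i \<omega>)\<^sup>2)" for k \<omega>
  proof -
    have "(Suc k)\<^sup>2 - k\<^sup>2 = 2 * k + 1" by (simp add: power2_eq_square)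
    then show ?thesis
      using Cauchy_Schwarz_ineq_sum[of "\<lambda>_. 1" "\<lambda>i. \<bar>D i \<omega>\<bar>" "{k\<^sup>2..<(Suc k)\<^sup>2}"]
      by (simp add: T_def)
  qed
  have T2: "integrable M (\<lambda>\<omega>. (T k \<omega>)\<^sup>2)" for k
  proof (rule Bochner_Integration.integrable_bound)
    show "integrable M (\<lambda>\<omega>. real (2 * k + 1) * (\<Sum>i\<in>{k\<^sup>2..<(Suc k)\<^sup>2}. (D i \<omega>)\<^sup>2))"
      using int by simp
    show "AE \<omega> in M. norm ((T k \<omega>)\<^sup>2)
        \<le> norm (real (2 * k + 1) * (\<Sum>i\<in>{k\<^sup>2..<(Suc k)\<^sup>2}. (D i \<omega>)\<^sup>2))"
      using T_le by (auto intro!: AE_I2 order_trans[OF _ abs_ge_self])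
  qed simp
  have ET: "(\<integral>\<omega>. (T k \<omega>)\<^sup>2 \<partial>M) \<le> (real (2 * k + 1))\<^sup>2 * C" for k
  proof -
    have "(\<integral>\<omega>. (T k \<omega>)\<^sup>2 \<partial>M)
        \<le> (\<integral>\<omega>. real (2 * k + 1) * (\<Sum>i\<in>{k\<^sup>2..<(Suc k)\<^sup>2}. (D i \<omega>)\<^sup>2) \<partial>M)"
      using T2 int T_le by (intro integral_mono) auto
    also have "\<dots> = real (2 * k + 1) * (\<Sum>i\<in>{k\<^sup>2..<(Suc k)\<^sup>2}. \<integral>\<omega>. (D i \<omega>)\<^sup>2 \<partial>M)"
      using int by (simp add: Bochner_Integration.integral_sum)
    also have "\<dots> \<le> real (2 * k + 1) * (\<Sum>i\<in>{k\<^sup>2..<(Suc k)\<^sup>2}. C)"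
      by (intro mult_left_mono sum_mono bound) simp
    also have "\<dots> = (real (2 * k + 1))\<^sup>2 * C"
      by (simp add: power2_eq_square)
    finally show ?thesis .
  qed
  have inv2: "summable (\<lambda>k. K * (1 / (real k)\<^sup>2))" for K
    using inverse_power_summable[of 2] by (intro summable_mult) (simp add: inverse_eq_divide)
  have "AE \<omega> in M. (\<lambda>k. (S (k\<^sup>2) \<omega> / (real k)\<^sup>2)\<^sup>2) \<longlonglongrightarrow> 0"
  proof (rule AE_tendsto_zero_of_summable_expectation)
    show "summable (\<lambda>k. \<integral>\<omega>. (S (k\<^sup>2) \<omega> / (real k)\<^sup>2)\<^sup>2 \<partial>M)"
    proof (rule summable_comparison_test'[OF inv2[of C]])
      fix k :: nat
      have "(\<integral>\<omega>. (S (k\<^sup>2) \<omega> / (real k)\<^sup>2)\<^sup>2 \<partial>M) = (\<integral>\<omega>. (S (k\<^sup>2) \<omega>)\<^sup>2 \<partial>M) / (real k) ^ 4"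
        by (simp add: power_divide)
      also have "\<dots> \<le> C * (real k)\<^sup>2 / (real k) ^ 4"
        using S2[of "k\<^sup>2"] by (intro divide_right_mono) auto
      also have "\<dots> = C * (1 / (real k)\<^sup>2)"
        by (simp add: power4_eq_xxxx power2_eq_square)
      finally show "norm (\<integral>\<omega>. (S (k\<^sup>2) \<omega> / (real k)\<^sup>2)\<^sup>2 \<partial>M) \<le> C * (1 / (real k)\<^sup>2)"
        by (simp add: integral_nonneg_AE)
    qed
  qed (use S2 in \<open>auto simp: power_divide\<close>)
  moreover have "AE \<omega> in M. (\<lambda>k. (T k \<omega> / (real k)\<^sup>2)\<^sup>2) \<longlonglongrightarrow> 0"
  proof (rule AE_tendsto_zero_of_summable_expectation)
    show "summable (\<lambda>k. \<integral>\<omega>. (T k \<omega> / (real k)\<^sup>2)\<^sup>2 \<partial>M)"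
    proof (rule summable_comparison_test'[OF inv2[of "9 * C"]])
      fix k :: nat
      \<comment> \<open>The 9 is the square of 3, from \<open>2 * k + 1 \<le> 3 * k\<close> for
        \<open>k \<ge> 1\<close>; at \<open>k = 0\<close> division by zero makes the term
        vanish.\<close>
      show "norm (\<integral>\<omega>. (T k \<omega> / (real k)\<^sup>2)\<^sup>2 \<partial>M) \<le> 9 * C * (1 / (real k)\<^sup>2)"
      proof (cases "k = 0")
        case False
        have "(\<integral>\<omega>. (T k \<omega> / (real k)\<^sup>2)\<^sup>2 \<partial>M) = (\<integral>\<omega>. (T k \<omega>)\<^sup>2 \<partial>M) / (real k) ^ 4"
          by (simp add: power_divide)
        also have "\<dots> \<le> (real (2 * k + 1))\<^sup>2 * C / (real k) ^ 4"
          using ET[of k] by (intro divide_right_mono) auto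
        also have "\<dots> \<le> (3 * real k)\<^sup>2 * C / (real k) ^ 4"
          using False C by (intro divide_right_mono mult_right_mono power_mono) auto
        also have "\<dots> = 9 * C * (1 / (real k)\<^sup>2)"
          by (simp add: power4_eq_xxxx power2_eq_square)
        finally show ?thesis by (simp add: integral_nonneg_AE)
      qed simp
    qed
  qed (use T2 in \<open>auto simp: power_divide\<close>)
  ultimately show ?thesis
  proof eventually_elim
    case (elim \<omega>)
    define g where "g k = \<bar>S (k\<^sup>2) \<omega> / (real k)\<^sup>2\<bar> + \<bar>T k \<omega> / (real k)\<^sup>2\<bar>" for k
    have "g \<longlonglongrightarrow> 0"
      unfolding g_def using tendsto_add[OF tendsto_real_sqrt[OF elim(1)] tendsto_real_sqrt[OF elim(2)]]
      by simp
    moreover have "filterlim floor_sqrt at_top sequentially"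
      unfolding filterlim_at_top
    proof
      fix Z
      show "eventually (\<lambda>n. Z \<le> floor_sqrt n) sequentially"
        using eventually_ge_at_top[of "Z\<^sup>2"] by eventually_elim (simp add: le_floor_sqrt_iff)
    qed
    ultimately have "(\<lambda>n. g (floor_sqrt n)) \<longlonglongrightarrow> 0" by (rule filterlim_compose)
    then show ?case
    proof (rule Lim_null_comparison[rotated])
      show "eventually (\<lambda>n. norm ((\<Sum>i<n. D i \<omega>) / real n) \<le> g (floor_sqrt n)) sequentially"
        using eventually_gt_at_top[of 0]
      proof eventually_elim
        case (elim n)
        define k where "k = floor_sqrt n"
        have kn: "k\<^sup>2 \<le> n" "n < (Suc k)\<^sup>2" unfolding k_def by (simp_all add: Suc_floor_sqrt_power2_gt)
        have k: "k > 0" using elim by (simp add: k_def)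
        have "{..<n} = {..<k\<^sup>2} \<union> {k\<^sup>2..<n}" using kn by auto
        then have "S n \<omega> = S (k\<^sup>2) \<omega> + (\<Sum>i\<in>{k\<^sup>2..<n}. D i \<omega>)"
          unfolding S_def by (metis finite_atLeastLessThan finite_lessThan ivl_disj_int_one(2) sum.union_disjoint lessThan_atLeast0 ivl_disj_int_two(3))
        moreover have "\<bar>\<Sum>i\<in>{k\<^sup>2..<n}. D i \<omega>\<bar> \<le> T k \<omega>"
          unfolding T_def using kn by (intro order_trans[OF sum_abs] sum_mono2) auto
        ultimately have "\<bar>S n \<omega>\<bar> \<le> \<bar>S (k\<^sup>2) \<omega>\<bar> + \<bar>T k \<omega>\<bar>" by linarith
        then have "\<bar>S n \<omega>\<bar> / real n \<le> (\<bar>S (k\<^sup>2) \<omega>\<bar> + \<bar>T k \<omega>\<bar>) / real n"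
          by (rule divide_right_mono) simp
        also have "\<dots> \<le> (\<bar>S (k\<^sup>2) \<omega>\<bar> + \<bar>T k \<omega>\<bar>) / (real k)\<^sup>2"
          using kn(1) k elim by (intro divide_left_mono) (auto simp flip: of_nat_power)
        also have "\<dots> = g k" by (simp add: g_def add_divide_distrib)
        finally show ?case by (simp add: S_def k_def)
      qed
    qed
  qed
qed

section \<open>Stable recursions and adapted noise\<close>

text \<open>The finitely many roots all lie outside the closed unit disc, hence outside a disc of
  radius \<open>r > 1\<close>. The reciprocal is analytic there, so its series converges absolutely
  at 1.\<close>

lemma summable_inverse_fps_of_poly:
  fixes P :: "complex poly"
  assumes nz: "\<And>z. cmod z \<le> 1 \<Longrightarrow> poly P z \<noteq> 0"
  shows "summable (\<lambda>n. cmod (fps_nth (inverse (fps_of_poly P)) n))"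
proof -
  \<comment> \<open>The extra 2 keeps the minimum meaningful when the polynomial is
    constant.\<close>
  let ?R = "insert 2 (cmod ` {z. poly P z = 0})"
  have "P \<noteq> 0" using nz[of 0] by auto
  then have fin: "finite ?R" using poly_roots_finite by blast
  define r where "r = Min ?R"
  have "r \<in> ?R" unfolding r_def by (intro Min_in fin) auto
  then have r: "r > 1" using nz by (force simp: not_le[symmetric])
  have "eval_fps (fps_of_poly P) z \<noteq> 0" if "ereal (norm z) < ereal r" for z
  proof
    assume "eval_fps (fps_of_poly P) z = 0"
    then have "r \<le> cmod z" unfolding r_def using fin by (intro Min_le) auto
    then show False using that by simp
  qed
  then have "ereal r \<le> fps_conv_radius (inverse (fps_of_poly P))"
    using fps_conv_radius_inverse[of "ereal r" "fps_of_poly P"] by simp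
  moreover have "1 < ereal r" using r by (simp add: one_ereal_def)
  ultimately have "1 < fps_conv_radius (inverse (fps_of_poly P))" by (rule less_le_trans[rotated])
  then have "summable (\<lambda>n. norm (fps_nth (inverse (fps_of_poly P)) n * 1 ^ n))"
    unfolding fps_conv_radius_def by (intro abs_summable_in_conv_radius) (simp add: one_ereal_def)
  then show ?thesis by simp
qed

text \<open>In terms of formal power series the recursion reads \<open>A * Y = F\<close>, so \<open>Y = inverse A * F\<close>.\<close>

lemma stable_recursion_bound:
  fixes a :: "nat \<Rightarrow> real"
  assumes nz: "\<And>z::complex. cmod z \<le> 1 \<Longrightarrow> 1 + (\<Sum>i\<in>{1..p}. complex_of_real (a i) * z ^ i) \<noteq> 0"
  obtains h :: "nat \<Rightarrow> real" where "\<And>n. 0 \<le> h n" "summable h"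
    "\<And>y f n. (\<And>n. f n = y n + (\<Sum>i\<in>{1..p}. a i * (if i \<le> n then y (n - i) else 0)))
       \<Longrightarrow> \<bar>y n\<bar> \<le> (\<Sum>i\<le>n. h i * \<bar>f (n - i)\<bar>)"
proof
  define P :: "complex poly" where "P = 1 + (\<Sum>i\<in>{1..p}. monom (complex_of_real (a i)) i)"
  define h where "h n = cmod (fps_nth (inverse (fps_of_poly P)) n)" for n
  have pP: "poly P z = 1 + (\<Sum>i\<in>{1..p}. complex_of_real (a i) * z ^ i)" for z
    by (simp add: P_def poly_sum poly_monom)
  have cP: "coeff P k = (if k = 0 then 1 else if k \<le> p then complex_of_real (a k) else 0)" for k
    by (auto simp: P_def coeff_sum)
  show "0 \<le> h n" for n by (simp add: h_def)
  show "summable h" unfolding h_def by (intro summable_inverse_fps_of_poly) (use nz pP in simp)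
  fix y f :: "nat \<Rightarrow> real" and n
  assume f: "\<And>n. f n = y n + (\<Sum>i\<in>{1..p}. a i * (if i \<le> n then y (n - i) else 0))"
  define Y where "Y = Abs_fps (\<lambda>n. complex_of_real (y n))"
  define F where "F = Abs_fps (\<lambda>n. complex_of_real (f n))"
  have "fps_of_poly P * Y = F"
  proof (rule fps_ext)
    fix m
    have "fps_nth (fps_of_poly P * Y) m
          = complex_of_real (\<Sum>i=0..m. (if i = 0 then 1 else if i \<le> p then a i else 0) * y (m - i))"
      by (auto simp: fps_mult_nth Y_def cP intro!: sum.cong)
    also have "(\<Sum>i=0..m. (if i = 0 then 1 else if i \<le> p then a i else 0) * y (m - i))
          = y m + (\<Sum>i\<in>{1..m}. (if i \<le> p then a i else 0) * y (m - i))"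
      by (subst sum.atLeast_Suc_atMost) (auto intro!: sum.cong)
    also have "(\<Sum>i\<in>{1..m}. (if i \<le> p then a i else 0) * y (m - i))
          = (\<Sum>i\<in>{1..p}. a i * (if i \<le> m then y (m - i) else 0))"
      by (rule sum.mono_neutral_cong) auto
    finally show "fps_nth (fps_of_poly P * Y) m = fps_nth F m" by (simp add: F_def f)
  qed
  moreover have "inverse (fps_of_poly P) * fps_of_poly P = 1"
    by (rule inverse_mult_eq_1) (simp add: cP)
  ultimately have "Y = inverse (fps_of_poly P) * F"
    by (metis mult.assoc mult_1)
  then have "complex_of_real (y n)
      = (\<Sum>i=0..n. fps_nth (inverse (fps_of_poly P)) i * complex_of_real (f (n - i)))"
    by (simp add: fps_eq_iff Y_def F_def fps_mult_nth)
  then have "\<bar>y n\<bar> = cmod (\<Sum>i=0..n. fps_nth (inverse (fps_of_poly P)) i * complex_of_real (f (n - i)))"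
    by (metis norm_of_real)
  also have "\<dots> \<le> (\<Sum>i\<le>n. h i * \<bar>f (n - i)\<bar>)"
    unfolding atMost_atLeast0 h_def by (intro order_trans[OF norm_sum] sum_mono) (simp add: norm_mult)
  finally show "\<bar>y n\<bar> \<le> (\<Sum>i\<le>n. h i * \<bar>f (n - i)\<bar>)" .
qed

text \<open>Convolution with a summable kernel preserves uniform boundedness in L2: Cauchy-Schwarz
  with weights \<open>h i\<close> moves the square inside the sum.\<close>

lemma second_moment_convolution:
  fixes y f :: "nat \<Rightarrow> 'a \<Rightarrow> real"
  assumes [measurable]: "\<And>n. y n \<in> borel_measurable M"
    and int: "\<And>n. integrable M (\<lambda>\<omega>. (f n \<omega>)\<^sup>2)"
    and bound: "\<And>n. (\<integral>\<omega>. (f n \<omega>)\<^sup>2 \<partial>M) \<le> C"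
    and h: "\<And>n. 0 \<le> h n" "summable h"
    and conv: "\<And>n \<omega>. \<bar>y n \<omega>\<bar> \<le> (\<Sum>i\<le>n. h i * \<bar>f (n - i) \<omega>\<bar>)"
  shows "integrable M (\<lambda>\<omega>. (y n \<omega>)\<^sup>2)" "(\<integral>\<omega>. (y n \<omega>)\<^sup>2 \<partial>M) \<le> (suminf h)\<^sup>2 * C"
proof -
  let ?H = "suminf h"
  have H: "(\<Sum>i\<le>n. h i) \<le> ?H" "0 \<le> ?H" for n
    using h by (auto intro!: sum_le_suminf suminf_nonneg)
  define G where "G \<omega> = ?H * (\<Sum>i\<le>n. h i * (f (n - i) \<omega>)\<^sup>2)" for \<omega>
  have le: "(y n \<omega>)\<^sup>2 \<le> G \<omega>" for \<omega>
  proof -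
    have "(y n \<omega>)\<^sup>2 \<le> (\<Sum>i\<le>n. h i * \<bar>f (n - i) \<omega>\<bar>)\<^sup>2"
      using conv[of n \<omega>] by (metis abs_ge_zero power2_abs power_mono)
    also have "\<dots> = (\<Sum>i\<le>n. sqrt (h i) * (sqrt (h i) * \<bar>f (n - i) \<omega>\<bar>))\<^sup>2"
      using h by (simp flip: mult.assoc)
    also have "\<dots> \<le> (\<Sum>i\<le>n. (sqrt (h i))\<^sup>2) * (\<Sum>i\<le>n. (sqrt (h i) * \<bar>f (n - i) \<omega>\<bar>)\<^sup>2)"
      by (rule Cauchy_Schwarz_ineq_sum)
    also have "\<dots> = (\<Sum>i\<le>n. h i) * (\<Sum>i\<le>n. h i * (f (n - i) \<omega>)\<^sup>2)"
      using h by (simp add: power_mult_distrib)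
    also have "\<dots> \<le> G \<omega>"
      unfolding G_def using h H by (intro mult_right_mono sum_nonneg) auto
    finally show ?thesis .
  qed
  have G: "integrable M G" unfolding G_def using int by simp
  show y2: "integrable M (\<lambda>\<omega>. (y n \<omega>)\<^sup>2)"
    using le by (intro Bochner_Integration.integrable_bound[OF G])
      (auto intro!: AE_I2 order_trans[OF _ abs_ge_self])
  have "0 \<le> (\<integral>\<omega>. (f 0 \<omega>)\<^sup>2 \<partial>M)" by (rule integral_nonneg_AE) simp
  then have C: "0 \<le> C" using bound[of 0] by linarith
  have "(\<integral>\<omega>. (y n \<omega>)\<^sup>2 \<partial>M) \<le> (\<integral>\<omega>. G \<omega> \<partial>M)"
    using y2 G le by (rule integral_mono)
  also have "\<dots> = ?H * (\<Sum>i\<le>n. h i * (\<integral>\<omega>. (f (n - i) \<omega>)\<^sup>2 \<partial>M))"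
    unfolding G_def using int by (simp add: Bochner_Integration.integral_sum)
  also have "\<dots> \<le> ?H * (\<Sum>i\<le>n. h i * C)"
    using H h bound by (intro mult_left_mono sum_mono) auto
  also have "\<dots> = ?H * ((\<Sum>i\<le>n. h i) * C)" by (simp add: sum_distrib_right)
  also have "\<dots> \<le> ?H * (?H * C)" using H C by (intro mult_left_mono mult_right_mono) auto
  finally show "(\<integral>\<omega>. (y n \<omega>)\<^sup>2 \<partial>M) \<le> ?H\<^sup>2 * C" by (simp add: power2_eq_square mult.assoc)
qed

text \<open>The sigma-algebra generated by the \<open>X i\<close> with \<open>i\<close> in
  \<open>A\<close>, encoded as the pullback of a product so that independence of restricted families
  applies to it directly.\<close>

definition sigma_gen :: "'a measure \<Rightarrow> ('i \<Rightarrow> 'a \<Rightarrow> real) \<Rightarrow> 'i set \<Rightarrow> 'a measure" where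
  "sigma_gen M X A = vimage_algebra (space M) (\<lambda>\<omega>. restrict (\<lambda>i. X i \<omega>) A) (PiM A (\<lambda>_. borel))"

lemma space_sigma_gen [simp]: "space (sigma_gen M X A) = space M"
  by (simp add: sigma_gen_def)

lemma measurable_sigma_gen_component:
  assumes "i \<in> A"
  shows "X i \<in> borel_measurable (sigma_gen M X A)"
proof -
  have "(\<lambda>\<omega>. restrict (\<lambda>i. X i \<omega>) A) \<in> sigma_gen M X A \<rightarrow>\<^sub>M PiM A (\<lambda>_. borel)"
    unfolding sigma_gen_def by (rule measurable_vimage_algebra1) (auto simp: space_PiM)
  then have "(\<lambda>\<omega>. restrict (\<lambda>i. X i \<omega>) A i) \<in> borel_measurable (sigma_gen M X A)"
    using assms by (rule measurable_compose[OF _ measurable_component_singleton])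
  then show ?thesis using assms by simp
qed

context prob_space
begin

text \<open>The blocks \<open>A\<close> and \<open>{j}\<close> are disjoint, so their restrictions
  are independent, and independence passes to the smaller sigma-algebras of \<open>Y\<close> and
  \<open>X j\<close>. Only measurability of \<open>Y\<close> is used; it need not be written as a
  function of the block.\<close>

lemma indep_var_sigma_gen:
  fixes X :: "'i \<Rightarrow> 'a \<Rightarrow> real"
  assumes indep: "indep_vars (\<lambda>_. borel) X UNIV"
    and j: "j \<notin> A" and Y: "Y \<in> borel_measurable (sigma_gen M X A)"
  shows "Y \<in> borel_measurable M" "indep_var borel Y borel (X j)"
proof -
  let ?R = "\<lambda>A \<omega>. restrict (\<lambda>i. X i \<omega>) A" and ?P = "\<lambda>A. PiM A (\<lambda>_. borel :: real measure)"
  have X: "X i \<in> borel_measurable M" for i using indep by (auto simp: indep_vars_def)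
  have sets: "sets (sigma_gen M X A) = sigma_sets (space M) {?R A -` B \<inter> space M | B. B \<in> sets (?P A)}"
    by (simp add: sigma_gen_def sets_vimage_algebra)
  have "indep_var (?P A) (?R A) (?P {j}) (?R {j})"
    using indep j by (intro indep_var_restrict) auto
  then have rv: "?R A \<in> M \<rightarrow>\<^sub>M ?P A"
    and ind: "indep_set (sigma_sets (space M) {?R A -` B \<inter> space M | B. B \<in> sets (?P A)})
      (sigma_sets (space M) {?R {j} -` B \<inter> space M | B. B \<in> sets (?P {j})})"
    unfolding indep_var_eq by auto
  have YA: "Y -` B \<inter> space M \<in> sets (sigma_gen M X A)" if "B \<in> sets borel" for B
    using measurable_sets[OF Y that] by simp
  have sub: "sets (sigma_gen M X A) \<subseteq> sets M"
    unfolding sets using rv by (intro sets.sigma_sets_subset) (auto intro: measurable_sets)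
  show YM: "Y \<in> borel_measurable M"
    using YA sub by (intro measurableI) auto
  have Xj: "X j -` B \<inter> space M \<in> sigma_sets (space M) {?R {j} -` B \<inter> space M | B. B \<in> sets (?P {j})}"
    if "B \<in> sets borel" for B
  proof -
    have "X j \<in> borel_measurable (sigma_gen M X {j})" by (rule measurable_sigma_gen_component) simp
    from measurable_sets[OF this that] show ?thesis by (simp add: sigma_gen_def sets_vimage_algebra)
  qed
  have Xs: "sigma_sets (space M) {X j -` B \<inter> space M | B. B \<in> sets borel}
      \<subseteq> sigma_sets (space M) {?R {j} -` B \<inter> space M | B. B \<in> sets (?P {j})}"
    using Xj by (intro sigma_sets_mono) auto
  have Ys: "sigma_sets (space M) {Y -` B \<inter> space M | B. B \<in> sets borel}
      \<subseteq> sigma_sets (space M) {?R A -` B \<inter> space M | B. B \<in> sets (?P A)}"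
    using YA unfolding sets by (intro sigma_sets_mono) auto
  have "indep_set (sigma_sets (space M) {Y -` B \<inter> space M | B. B \<in> sets borel})
      (sigma_sets (space M) {X j -` B \<inter> space M | B. B \<in> sets borel})"
    using ind unfolding indep_set_def
    by (rule indep_sets_mono_sets) (use Ys Xs in \<open>simp split: bool.split\<close>)
  then show "indep_var borel Y borel (X j)" unfolding indep_var_eq using YM X by simp
qed

lemma std_normal_moments:
  assumes w: "distributed M lborel w std_normal_density"
  shows "integrable M w" "integrable M (\<lambda>\<omega>. (w \<omega>)\<^sup>2)" "expectation w = 0"
    "expectation (\<lambda>\<omega>. (w \<omega>)\<^sup>2) = 1"
proof -
  show "integrable M w"
    using distributed_integrable[OF w, of "\<lambda>x. x"] integrable_std_normal_moment[of 1] by simp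
  show "integrable M (\<lambda>\<omega>. (w \<omega>)\<^sup>2)"
    using distributed_integrable[OF w, of "\<lambda>x. x\<^sup>2"] integrable_std_normal_moment[of 2] by simp
  show E: "expectation w = 0" by (rule standard_normal_distributed_expectation[OF w])
  show "expectation (\<lambda>\<omega>. (w \<omega>)\<^sup>2) = 1"
    using standard_normal_distributed_variance[OF w] by (simp add: E)
qed

lemma slln_adapted_noise:
  fixes u w X :: "nat \<Rightarrow> 'a \<Rightarrow> real"
  assumes indep: "indep_vars (\<lambda>_. borel) (case_sum u w) UNIV"
    and w: "\<And>n. distributed M lborel (w n) std_normal_density"
    and adapted: "\<And>i j. i \<le> j \<Longrightarrow>
          X i \<in> borel_measurable (sigma_gen M (case_sum u w) (Inl ` {..j} \<union> Inr ` {..j}))"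
    and int: "\<And>i. integrable M (\<lambda>\<omega>. (X i \<omega>)\<^sup>2)"
    and bound: "\<And>i. expectation (\<lambda>\<omega>. (X i \<omega>)\<^sup>2) \<le> C"
  shows "AE \<omega> in M. (\<lambda>n. (\<Sum>i<n. X i \<omega> * w (Suc i) \<omega>) / real n) \<longlonglongrightarrow> 0"
proof -
  define G where "G j = sigma_gen M (case_sum u w) (Inl ` {..j} \<union> Inr ` {..j})" for j :: nat
  have ind: "Y \<in> borel_measurable M" "indep_var borel Y borel (w (Suc j))"
    if "Y \<in> borel_measurable (G j)" for Y j
  proof -
    have "Inr (Suc j) \<notin> Inl ` {..j} \<union> Inr ` {..j}" by auto
    from indep_var_sigma_gen[OF indep this that[unfolded G_def]]
    show "Y \<in> borel_measurable M" "indep_var borel Y borel (w (Suc j))" by simp_all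
  qed
  have XG: "X i \<in> borel_measurable (G j)" if "i \<le> j" for i j
    using adapted[OF that] by (simp add: G_def)
  have wG: "w i \<in> borel_measurable (G j)" if "i \<le> j" for i j
  proof -
    have "Inr i \<in> Inl ` {..j} \<union> Inr ` {..j}" using that by simp
    from measurable_sigma_gen_component[OF this, of "case_sum u w" M] show ?thesis
      by (simp add: G_def)
  qed
  have [measurable]: "X i \<in> borel_measurable M" for i using ind(1)[OF XG[OF order_refl]] .
  have [measurable]: "w i \<in> borel_measurable M" for i using ind(1)[OF wG[OF order_refl]] .
  note mom = std_normal_moments[OF w]
  have D2: "integrable M (\<lambda>\<omega>. (X i \<omega> * w (Suc i) \<omega>)\<^sup>2)"
    "expectation (\<lambda>\<omega>. (X i \<omega> * w (Suc i) \<omega>)\<^sup>2) \<le> C" for i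
  proof -
    have "indep_var borel ((\<lambda>x. x\<^sup>2) \<circ> X i) borel ((\<lambda>x. x\<^sup>2) \<circ> w (Suc i))"
      by (rule indep_var_compose[OF ind(2)[OF XG[OF order_refl]]]) auto
    then have sq: "indep_var borel (\<lambda>\<omega>. (X i \<omega>)\<^sup>2) borel (\<lambda>\<omega>. (w (Suc i) \<omega>)\<^sup>2)"
      by (simp add: comp_def)
    show "integrable M (\<lambda>\<omega>. (X i \<omega> * w (Suc i) \<omega>)\<^sup>2)"
      using indep_var_integrable[OF sq int mom(2)] by (simp add: power_mult_distrib)
    show "expectation (\<lambda>\<omega>. (X i \<omega> * w (Suc i) \<omega>)\<^sup>2) \<le> C"
      using indep_var_lebesgue_integral[OF sq int mom(2)] bound[of i]
      by (simp add: power_mult_distrib mom(4))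
  qed
  show ?thesis
  proof (rule slln_uncorrelated[OF _ D2])
    show "(\<lambda>\<omega>. X i \<omega> * w (Suc i) \<omega>) \<in> borel_measurable M" for i by simp
    show "expectation (\<lambda>\<omega>. X i \<omega> * w (Suc i) \<omega> * (X j \<omega> * w (Suc j) \<omega>)) = 0" if "i < j" for i j
    proof -
      \<comment> \<open>All factors except the newest noise \<open>w (Suc j)\<close>;
        \<open>i < j\<close> puts \<open>w (Suc i)\<close> into the past of time
        \<open>j\<close>.\<close>
      define Y where "Y \<omega> = X i \<omega> * w (Suc i) \<omega> * X j \<omega>" for \<omega>
      have YG: "Y \<in> borel_measurable (G j)"
        unfolding Y_def using that by (intro borel_measurable_times XG wG) auto
      have YI: "integrable M Y"
        unfolding Y_def by (intro integrable_mult_of_squares D2 int) simp_all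
      have "expectation (\<lambda>\<omega>. Y \<omega> * w (Suc j) \<omega>) = 0"
        using indep_var_lebesgue_integral[OF ind(2)[OF YG] YI mom(1)] by (simp add: mom(3))
      then show ?thesis by (simp add: Y_def mult.assoc)
    qed
  qed
qed

end

section \<open>Quantized ARX systems\<close>

lemma quant_error:
  assumes "0 < eps"
  shows "\<bar>quant eps y - y\<bar> \<le> eps / 2"
proof -
  let ?r = "y / eps + 1 / 2"
  have "real_of_int \<lfloor>?r\<rfloor> \<le> ?r" "?r < real_of_int \<lfloor>?r\<rfloor> + 1" by linarith+
  then have "\<bar>real_of_int \<lfloor>?r\<rfloor> - y / eps\<bar> \<le> 1 / 2" by linarith
  then have "eps * \<bar>real_of_int \<lfloor>?r\<rfloor> - y / eps\<bar> \<le> eps * (1 / 2)"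
    using assms by (intro mult_left_mono) auto
  moreover have "\<bar>quant eps y - y\<bar> = eps * \<bar>real_of_int \<lfloor>?r\<rfloor> - y / eps\<bar>"
    using assms by (simp add: quant_def abs_mult_pos' field_simps)
  ultimately show ?thesis by simp
qed

lemma sum_lessThan_add:
  fixes f :: "nat \<Rightarrow> 'a :: comm_monoid_add"
  shows "(\<Sum>k<m + n. f k) = (\<Sum>k<m. f k) + (\<Sum>k<n. f (m + k))"
  by (induction n) (simp_all add: add.assoc)

text \<open>Passes to the indexing of the system equation: coordinate \<open>k\<close> of a block
  carries lag \<open>j = k + 1\<close>, and the condition \<open>j \<le> i\<close> excludes time
  0.\<close>

lemma theta_bar_scalar_prod_psi_eq:
  assumes "p0 \<le> p"
  shows "theta_bar a b p0 q0 p q0 \<bullet> psi s u p q0 i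
    = - (\<Sum>j\<in>{1..p0}. a j * (if j \<le> i then s (Suc i - j) else 0))
      + (\<Sum>j\<in>{1..q0}. b j * (if j \<le> i then u (Suc i - j) else 0))"
proof -
  have "theta_bar a b p0 q0 p q0 \<bullet> psi s u p q0 i
      = (\<Sum>k<p. - (if k + 1 \<le> p0 then a (k + 1) else 0) * (if k < i then s (i - k) else 0))
        + (\<Sum>k<q0. b (k + 1) * (if k < i then u (i - k) else 0))"
    by (simp add: scalar_prod_eq_sum[of _ "p + q0"] theta_bar_def psi_def sum_lessThan_add cong: if_cong)
  also have "(\<Sum>k<p. - (if k + 1 \<le> p0 then a (k + 1) else 0) * (if k < i then s (i - k) else 0))
      = (\<Sum>k<p0. - (a (Suc k) * (if Suc k \<le> i then s (Suc i - Suc k) else 0)))"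
    using assms by (intro sum.mono_neutral_cong_right) auto
  finally show ?thesis
    by (simp add: sum.atLeast1_atMost_eq sum_negf Suc_le_eq cong: if_cong)
qed

text \<open>The polynomial A(z) applied to the quantization error s - y, without the contribution of
  time 0.\<close>

definition quant_noise :: "(nat \<Rightarrow> real) \<Rightarrow> nat \<Rightarrow> (nat \<Rightarrow> real) \<Rightarrow> (nat \<Rightarrow> real) \<Rightarrow> nat \<Rightarrow> real" where
  "quant_noise a p0 s y i = (s (Suc i) - y (Suc i))
     + (\<Sum>j\<in>{1..p0}. a j * (if j \<le> i then s (Suc i - j) - y (Suc i - j) else 0))"

text \<open>The regressors omit the time-0 values, which the system equation uses.\<close>

definition initial_term :: "(nat \<Rightarrow> real) \<Rightarrow> (nat \<Rightarrow> real) \<Rightarrow> nat \<Rightarrow> nat \<Rightarrow> real \<Rightarrow> real \<Rightarrow> nat \<Rightarrow> real" where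
  "initial_term a b p0 q0 y0 u0 i = - (\<Sum>j\<in>{1..p0}. a j * (if j = Suc i then y0 else 0))
     + (\<Sum>j\<in>{1..q0}. b j * (if j = Suc i then u0 else 0))"

lemma quantized_regression:
  fixes y u w s a b :: "nat \<Rightarrow> real"
  assumes sys: "y (Suc i) = - (\<Sum>j\<in>{1..p0}. a j * (if j \<le> Suc i then y (Suc i - j) else 0))
      + (\<Sum>j\<in>{1..q0}. b j * (if j \<le> Suc i then u (Suc i - j) else 0)) + w (Suc i)"
    and p: "p0 \<le> p"
  shows "s (Suc i) = theta_bar a b p0 q0 p q0 \<bullet> psi s u p q0 i + quant_noise a p0 s y i
           + (w (Suc i) + initial_term a b p0 q0 (y 0) (u 0) i)"
proof -
  have "(\<Sum>j\<in>{1..p0}. a j * (if j \<le> Suc i then y (Suc i - j) else 0))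
      = (\<Sum>j\<in>{1..p0}. a j * (if j \<le> i then s (Suc i - j) else 0))
        - (\<Sum>j\<in>{1..p0}. a j * (if j \<le> i then s (Suc i - j) - y (Suc i - j) else 0))
        + (\<Sum>j\<in>{1..p0}. a j * (if j = Suc i then y 0 else 0))"
    unfolding sum_subtractf[symmetric] sum.distrib[symmetric]
    by (intro sum.cong refl) (auto simp: algebra_simps le_Suc_eq)
  moreover have "(\<Sum>j\<in>{1..q0}. b j * (if j \<le> Suc i then u (Suc i - j) else 0))
      = (\<Sum>j\<in>{1..q0}. b j * (if j \<le> i then u (Suc i - j) else 0))
        + (\<Sum>j\<in>{1..q0}. b j * (if j = Suc i then u 0 else 0))"
    unfolding sum.distrib[symmetric] by (intro sum.cong refl) (auto simp: le_Suc_eq)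
  ultimately show ?thesis
    unfolding theta_bar_scalar_prod_psi_eq[OF p] quant_noise_def initial_term_def
    using sys by linarith
qed

lemma quant_noise_bound:
  assumes a: "\<And>j. 1 \<le> j \<Longrightarrow> j \<le> p0 \<Longrightarrow> \<bar>a j\<bar> \<le> c" and e: "\<And>k. \<bar>s k - y k\<bar> \<le> e"
  shows "\<bar>quant_noise a p0 s y i\<bar> \<le> (1 + real p0 * c) * e"
proof -
  have e0: "0 \<le> e" using e[of 0] by linarith
  have "\<bar>\<Sum>j\<in>{1..p0}. a j * (if j \<le> i then s (Suc i - j) - y (Suc i - j) else 0)\<bar> \<le> (\<Sum>j\<in>{1..p0}. c * e)"
  proof (intro order_trans[OF sum_abs] sum_mono)
    fix j assume "j \<in> {1..p0}"
    then show "\<bar>a j * (if j \<le> i then s (Suc i - j) - y (Suc i - j) else 0)\<bar> \<le> c * e"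
      using a[of j] e[of "Suc i - j"] e0 unfolding abs_mult by (intro mult_mono) auto
  qed
  then show ?thesis
    unfolding quant_noise_def using e[of "Suc i"] by (simp add: algebra_simps)
qed

lemma average_eventually_zero:
  fixes x :: "nat \<Rightarrow> real"
  assumes "\<And>i. N \<le> i \<Longrightarrow> x i = 0"
  shows "(\<lambda>n. (\<Sum>i<n. x i) / real n) \<longlonglongrightarrow> 0"
proof -
  have "eventually (\<lambda>n. (\<Sum>i<N. x i) / real n = (\<Sum>i<n. x i) / real n) sequentially"
    using eventually_ge_at_top[of N]
  proof eventually_elim
    case (elim n)
    then have "(\<Sum>i<N. x i) = (\<Sum>i<n. x i)" using assms by (intro sum.mono_neutral_left) auto
    then show ?case by simp
  qed
  then show ?thesis using lim_const_over_n by (rule Lim_transform_eventually[rotated])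
qed

section \<open>Second moments and noise averages of the ARX process\<close>

lemma sum_squares_le_double: "(x + y)\<^sup>2 \<le> 2 * x\<^sup>2 + 2 * (y :: real)\<^sup>2"
  using zero_le_power2[of "x - y"] by (simp add: power2_eq_square algebra_simps)

lemma (in prob_space) uniform_second_moment:
  fixes X :: "'a \<Rightarrow> real"
  assumes D: "distributed M lborel X (\<lambda>x. indicator {-\<delta>..\<delta>} x / measure lborel {-\<delta>..\<delta>})"
  shows "AE \<omega> in M. \<bar>X \<omega>\<bar> \<le> \<delta>" "integrable M (\<lambda>\<omega>. (X \<omega>)\<^sup>2)"
    "expectation (\<lambda>\<omega>. (X \<omega>)\<^sup>2) \<le> \<delta>\<^sup>2"
proof -
  have [measurable]: "X \<in> borel_measurable M" using distributed_measurable[OF D] by simp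
  show ae: "AE \<omega> in M. \<bar>X \<omega>\<bar> \<le> \<delta>"
  proof -
    have P: "Measurable.pred lborel (\<lambda>x. x \<in> {-\<delta>..\<delta>})" by measurable
    have "AE \<omega> in M. X \<omega> \<in> {-\<delta>..\<delta>}"
      unfolding distributed_AE2[OF D P] by (intro AE_I2) (auto split: split_indicator)
    then show ?thesis by eventually_elim auto
  qed
  have ae2: "AE \<omega> in M. (X \<omega>)\<^sup>2 \<le> \<delta>\<^sup>2"
    using ae by eventually_elim (metis abs_ge_zero power2_abs power_mono)
  show int: "integrable M (\<lambda>\<omega>. (X \<omega>)\<^sup>2)"
    by (rule integrable_const_bound[of _ "\<delta>\<^sup>2"]) (use ae2 in auto)
  have "expectation (\<lambda>\<omega>. (X \<omega>)\<^sup>2) \<le> expectation (\<lambda>_. \<delta>\<^sup>2)"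
    using int ae2 by (intro integral_mono_AE) auto
  then show "expectation (\<lambda>\<omega>. (X \<omega>)\<^sup>2) \<le> \<delta>\<^sup>2" by (simp add: prob_space)
qed

text \<open>The driving term, noise plus filtered input, has bounded second moments because the
  input is almost surely bounded; stability transfers this to the output, uniformly in time.\<close>

lemma (in prob_space) arx_second_moment:
  fixes u w y :: "nat \<Rightarrow> 'a \<Rightarrow> real" and a b :: "nat \<Rightarrow> real"
  assumes y0: "\<And>\<omega>. y 0 \<omega> = w 0 \<omega>"
    and sys: "\<And>n \<omega>. y (Suc n) \<omega> =
         - (\<Sum>i\<in>{1..p0}. a i * (if i \<le> Suc n then y (Suc n - i) \<omega> else 0))
         + (\<Sum>j\<in>{1..q0}. b j * (if j \<le> Suc n then u (Suc n - j) \<omega> else 0))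
         + w (Suc n) \<omega>"
    and stable: "\<And>z::complex. cmod z \<le> 1 \<Longrightarrow> 1 + (\<Sum>i\<in>{1..p0}. complex_of_real (a i) * z ^ i) \<noteq> 0"
    and y_meas: "\<And>n. y n \<in> borel_measurable M"
    and w: "\<And>n. distributed M lborel (w n) std_normal_density"
    and u_meas: "\<And>n. u n \<in> borel_measurable M" and u: "\<And>n. AE \<omega> in M. \<bar>u n \<omega>\<bar> \<le> \<delta>"
  obtains C where "\<And>n. integrable M (\<lambda>\<omega>. (y n \<omega>)\<^sup>2)" "\<And>n. expectation (\<lambda>\<omega>. (y n \<omega>)\<^sup>2) \<le> C"
proof -
  note [measurable] = u_meas
  have [measurable]: "w n \<in> borel_measurable M" for n using distributed_measurable[OF w] by simp
  define g where "g n \<omega> = (\<Sum>j\<in>{1..q0}. b j * (if j \<le> n then u (n - j) \<omega> else 0))" for n \<omega>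
  define f where "f n \<omega> = w n \<omega> + g n \<omega>" for n \<omega>
  \<comment> \<open>The sign of \<delta> is not assumed here, hence the absolute value.\<close>
  define B where "B = (\<Sum>j\<in>{1..q0}. \<bar>b j\<bar> * \<bar>\<delta>\<bar>)"
  have [measurable]: "f n \<in> borel_measurable M" for n
    unfolding f_def g_def by (intro borel_measurable_add borel_measurable_sum borel_measurable_times) auto
  have f2: "AE \<omega> in M. (f n \<omega>)\<^sup>2 \<le> 2 * (w n \<omega>)\<^sup>2 + 2 * B\<^sup>2" for n
  proof -
    have "AE \<omega> in M. \<forall>k. \<bar>u k \<omega>\<bar> \<le> \<delta>" using u by (subst AE_all_countable) auto
    then show ?thesis
    proof eventually_elim
      case (elim \<omega>)
      have "\<bar>g n \<omega>\<bar> \<le> B"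
        unfolding g_def B_def
      proof (intro order_trans[OF sum_abs] sum_mono)
        fix j
        show "\<bar>b j * (if j \<le> n then u (n - j) \<omega> else 0)\<bar> \<le> \<bar>b j\<bar> * \<bar>\<delta>\<bar>"
          using elim[rule_format, of "n - j"] unfolding abs_mult by (intro mult_left_mono) auto
      qed
      then have "(g n \<omega>)\<^sup>2 \<le> B\<^sup>2" by (metis abs_ge_zero power2_abs power_mono)
      then show ?case
        using sum_squares_le_double[of "w n \<omega>" "g n \<omega>"] by (simp add: f_def)
    qed
  qed
  note mom = std_normal_moments[OF w]
  have int_f: "integrable M (\<lambda>\<omega>. (f n \<omega>)\<^sup>2)" for n
  proof (rule Bochner_Integration.integrable_bound)
    show "integrable M (\<lambda>\<omega>. 2 * (w n \<omega>)\<^sup>2 + 2 * B\<^sup>2)" using mom(2) by simp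
    show "AE \<omega> in M. norm ((f n \<omega>)\<^sup>2) \<le> norm (2 * (w n \<omega>)\<^sup>2 + 2 * B\<^sup>2)"
      using f2[of n] by eventually_elim simp
  qed simp
  have E_f: "expectation (\<lambda>\<omega>. (f n \<omega>)\<^sup>2) \<le> 2 + 2 * B\<^sup>2" for n
  proof -
    have "expectation (\<lambda>\<omega>. (f n \<omega>)\<^sup>2) \<le> expectation (\<lambda>\<omega>. 2 * (w n \<omega>)\<^sup>2 + 2 * B\<^sup>2)"
      using int_f mom(2) f2[of n] by (intro integral_mono_AE) auto
    also have "\<dots> = 2 + 2 * B\<^sup>2" using mom(2,4) by (simp add: prob_space)
    finally show ?thesis .
  qed
  \<comment> \<open>The kernel depends on the coefficients only, so one \<open>h\<close> serves all
    outcomes.\<close>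
  obtain h :: "nat \<Rightarrow> real" where h: "\<And>n. 0 \<le> h n" "summable h"
    and conv: "\<And>y f n. (\<And>n. f n = y n + (\<Sum>i\<in>{1..p0}. a i * (if i \<le> n then y (n - i) else 0)))
       \<Longrightarrow> \<bar>y n\<bar> \<le> (\<Sum>i\<le>n. h i * \<bar>f (n - i)\<bar>)"
    using stable_recursion_bound[OF stable] by blast
  have rec: "f n \<omega> = y n \<omega> + (\<Sum>i\<in>{1..p0}. a i * (if i \<le> n then y (n - i) \<omega> else 0))" for n \<omega>
  proof (cases n)
    case 0
    have "(\<Sum>i\<in>{1..p0}. a i * (if i \<le> 0 then y (0 - i) \<omega> else 0)) = 0"
      "(\<Sum>j\<in>{1..q0}. b j * (if j \<le> 0 then u (0 - j) \<omega> else 0)) = 0"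
      by (intro sum.neutral; simp)+
    then show ?thesis by (simp only: 0 f_def g_def y0)
  next
    case (Suc m)
    show ?thesis unfolding Suc f_def g_def using sys[of m \<omega>] by linarith
  qed
  have conv': "\<bar>y n \<omega>\<bar> \<le> (\<Sum>i\<le>n. h i * \<bar>f (n - i) \<omega>\<bar>)" for n \<omega>
    using conv[of "\<lambda>n. f n \<omega>" "\<lambda>n. y n \<omega>" n] rec by blast
  show ?thesis
    using that[OF second_moment_convolution[OF y_meas int_f E_f h conv']] .
qed

text \<open>Unrolling the recursion shows that outputs up to time \<open>i\<close> are measurable
  with respect to inputs and noises up to time \<open>i\<close>. Quantization preserves this and
  changes second moments by a bounded amount.\<close>

lemma (in prob_space) arx_noise_average:
  fixes u w y :: "nat \<Rightarrow> 'a \<Rightarrow> real" and a b :: "nat \<Rightarrow> real"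
  assumes y0: "\<And>\<omega>. y 0 \<omega> = w 0 \<omega>"
    and sys: "\<And>n \<omega>. y (Suc n) \<omega> =
         - (\<Sum>i\<in>{1..p0}. a i * (if i \<le> Suc n then y (Suc n - i) \<omega> else 0))
         + (\<Sum>j\<in>{1..q0}. b j * (if j \<le> Suc n then u (Suc n - j) \<omega> else 0))
         + w (Suc n) \<omega>"
    and stable: "\<And>z::complex. cmod z \<le> 1 \<Longrightarrow> 1 + (\<Sum>i\<in>{1..p0}. complex_of_real (a i) * z ^ i) \<noteq> 0"
    and indep: "indep_vars (\<lambda>_. borel) (case_sum u w) UNIV"
    and w: "\<And>n. distributed M lborel (w n) std_normal_density"
    and u: "\<And>n. distributed M lborel (u n) (\<lambda>x. indicator {-\<delta>..\<delta>} x / measure lborel {-\<delta>..\<delta>})"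
    and eps: "0 < eps" and k: "k < p + q"
  shows "AE \<omega> in M. (\<lambda>n. (\<Sum>i<n. psi (\<lambda>k. quant eps (y k \<omega>)) (\<lambda>k. u k \<omega>) p q i $ k * w (Suc i) \<omega>)
           / real n) \<longlonglongrightarrow> 0"
proof -
  let ?G = "\<lambda>j. sigma_gen M (case_sum u w) (Inl ` {..j} \<union> Inr ` {..j})"
  let ?s = "\<lambda>l \<omega>. quant eps (y l \<omega>)"
  have uG: "u l \<in> borel_measurable (?G j)" if "l \<le> j" for l j
  proof -
    have "Inl l \<in> Inl ` {..j} \<union> Inr ` {..j}" using that by simp
    from measurable_sigma_gen_component[OF this, of "case_sum u w" M] show ?thesis by simp
  qed
  have wG: "w l \<in> borel_measurable (?G j)" if "l \<le> j" for l j
  proof -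
    have "Inr l \<in> Inl ` {..j} \<union> Inr ` {..j}" using that by simp
    from measurable_sigma_gen_component[OF this, of "case_sum u w" M] show ?thesis by simp
  qed
  have yG: "y l \<in> borel_measurable (?G j)" if "l \<le> j" for l j
    using that
  proof (induction l rule: less_induct)
    case (less l)
    show ?case
    proof (cases l)
      case 0
      have "y 0 = w 0" using y0 by (rule ext)
      then show ?thesis using wG less.prems 0 by simp
    next
      case (Suc n)
      have Y: "(\<lambda>\<omega>. if i \<le> Suc n then y (Suc n - i) \<omega> else 0) \<in> borel_measurable (?G j)"
        if "i \<in> {1..p0}" for i
        using that less Suc by (cases "i \<le> Suc n") auto
      have U: "(\<lambda>\<omega>. if i \<le> Suc n then u (Suc n - i) \<omega> else 0) \<in> borel_measurable (?G j)" for i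
        using uG[of "Suc n - i" j] less.prems Suc by (cases "i \<le> Suc n") auto
      have "y (Suc n) = (\<lambda>\<omega>.
         - (\<Sum>i\<in>{1..p0}. a i * (if i \<le> Suc n then y (Suc n - i) \<omega> else 0))
         + (\<Sum>j\<in>{1..q0}. b j * (if j \<le> Suc n then u (Suc n - j) \<omega> else 0))
         + w (Suc n) \<omega>)" using sys by (rule ext)
      moreover have "\<dots> \<in> borel_measurable (?G j)"
        using less.prems Suc
        by (intro borel_measurable_add borel_measurable_uminus borel_measurable_sum
            borel_measurable_times borel_measurable_const Y U wG) auto
      ultimately show ?thesis using Suc by simp
    qed
  qed
  have sG: "?s l \<in> borel_measurable (?G j)" if "l \<le> j" for l j
  proof -
    note [measurable] = yG[OF that]
    show ?thesis unfolding quant_def by measurable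
  qed
  have past: "Inr (Suc j) \<notin> Inl ` {..j} \<union> Inr ` {..j}" for j :: nat by auto
  note M = indep_var_sigma_gen(1)[OF indep past]
  have [measurable]: "y l \<in> borel_measurable M" "u l \<in> borel_measurable M"
    "?s l \<in> borel_measurable M" for l
    using M[OF yG[OF order_refl]] M[OF uG[OF order_refl]] M[OF sG[OF order_refl]] by simp_all
  obtain C where C: "\<And>n. integrable M (\<lambda>\<omega>. (y n \<omega>)\<^sup>2)" "\<And>n. expectation (\<lambda>\<omega>. (y n \<omega>)\<^sup>2) \<le> C"
    using arx_second_moment[OF y0 sys stable _ w _ uniform_second_moment(1)[OF u]] by auto
  have s_le: "(?s l \<omega>)\<^sup>2 \<le> 2 * (y l \<omega>)\<^sup>2 + 2 * (eps / 2)\<^sup>2" for l \<omega>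
  proof -
    have "(?s l \<omega> - y l \<omega>)\<^sup>2 \<le> (eps / 2)\<^sup>2"
      using quant_error[OF eps, of "y l \<omega>"] by (metis abs_ge_zero power2_abs power_mono)
    then show ?thesis using sum_squares_le_double[of "y l \<omega>" "?s l \<omega> - y l \<omega>"] by simp
  qed
  have s_int: "integrable M (\<lambda>\<omega>. (?s l \<omega>)\<^sup>2)" for l
  proof (rule Bochner_Integration.integrable_bound)
    show "integrable M (\<lambda>\<omega>. 2 * (y l \<omega>)\<^sup>2 + 2 * (eps / 2)\<^sup>2)" using C(1) by simp
    show "AE \<omega> in M. norm ((?s l \<omega>)\<^sup>2) \<le> norm (2 * (y l \<omega>)\<^sup>2 + 2 * (eps / 2)\<^sup>2)"
      using s_le by (intro AE_I2) simp
  qed simp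
  have s_E: "expectation (\<lambda>\<omega>. (?s l \<omega>)\<^sup>2) \<le> 2 * C + 2 * (eps / 2)\<^sup>2" for l
  proof -
    have "expectation (\<lambda>\<omega>. (?s l \<omega>)\<^sup>2) \<le> expectation (\<lambda>\<omega>. 2 * (y l \<omega>)\<^sup>2 + 2 * (eps / 2)\<^sup>2)"
      using s_int C(1) s_le by (intro integral_mono) auto
    also have "\<dots> \<le> 2 * C + 2 * (eps / 2)\<^sup>2" using C[of l] by (simp add: prob_space)
    finally show ?thesis .
  qed
  define X where "X i \<omega> = psi (\<lambda>k. ?s k \<omega>) (\<lambda>k. u k \<omega>) p q i $ k" for i \<omega>
  have "0 \<le> expectation (\<lambda>\<omega>. (y 0 \<omega>)\<^sup>2)" by (rule integral_nonneg_AE) simp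
  then have C0: "0 \<le> C" using C(2)[of 0] by linarith
  \<comment> \<open>A fixed coordinate is 0, a quantized output or an input, in the latter cases
    from a time not after \<open>i\<close>.\<close>
  have X_cases: "X i = (\<lambda>_. 0) \<or> (\<exists>l\<le>i. X i = ?s l) \<or> (\<exists>l\<le>i. X i = u l)" for i
  proof -
    have "X i = (if k < p then if k < i then ?s (i - k) else (\<lambda>_. 0)
        else if k - p < i then u (i - (k - p)) else (\<lambda>_. 0))"
      using k by (auto simp: X_def[abs_def] psi_def)
    then show ?thesis by (metis diff_le_self)
  qed
  have "AE \<omega> in M. (\<lambda>n. (\<Sum>i<n. X i \<omega> * w (Suc i) \<omega>) / real n) \<longlonglongrightarrow> 0"
  proof (rule slln_adapted_noise[OF indep w])
    show "X i \<in> borel_measurable (?G j)" if "i \<le> j" for i j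
      using X_cases[of i] that sG[of _ j] uG[of _ j] by (auto intro: order_trans)
    show "integrable M (\<lambda>\<omega>. (X i \<omega>)\<^sup>2)" for i
      using X_cases[of i] s_int uniform_second_moment(2)[OF u] by auto
    show "expectation (\<lambda>\<omega>. (X i \<omega>)\<^sup>2) \<le> 2 * C + 2 * (eps / 2)\<^sup>2 + \<delta>\<^sup>2" for i
    proof -
      have "expectation (\<lambda>\<omega>. (?s l \<omega>)\<^sup>2) \<le> 2 * C + 2 * (eps / 2)\<^sup>2 + \<delta>\<^sup>2"
        "expectation (\<lambda>\<omega>. (u l \<omega>)\<^sup>2) \<le> 2 * C + 2 * (eps / 2)\<^sup>2 + \<delta>\<^sup>2" for l
        using s_E[of l] uniform_second_moment(3)[OF u, of l] C0
          zero_le_power2[of \<delta>] zero_le_power2[of "eps / 2"] by linarith+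
      then show ?thesis using X_cases[of i] C0 by auto
    qed
  qed
  then show ?thesis by (simp add: X_def)
qed

theorem theorem2:
  fixes M :: "'w measure"
    and a b :: "nat \<Rightarrow> real" and p0 q0 pstar qstar :: nat
    and u w y :: "nat \<Rightarrow> 'w \<Rightarrow> real"
    and \<delta> c eps c2 c4 \<gamma>' \<beta>1 \<beta>2 :: real
    and v :: "nat \<Rightarrow> real"
  assumes prob: "prob_space M"
    \<comment> \<open>orders and leading coefficients\<close>
    and q0_pos: "1 \<le> q0"
    and a_lead: "0 < p0 \<longrightarrow> a p0 \<noteq> 0"
    and b_lead: "b q0 \<noteq> 0"
    \<comment> \<open>system equation, with y_n = u_n = 0 for n < 0 (and y_0 = w_0)\<close>
    and y0: "\<And>\<omega>. y 0 \<omega> = w 0 \<omega>"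
    and sys: "\<And>n \<omega>. y (Suc n) \<omega> =
         - (\<Sum>i\<in>{1..p0}. a i * (if i \<le> Suc n then y (Suc n - i) \<omega> else 0))
         + (\<Sum>j\<in>{1..q0}. b j * (if j \<le> Suc n then u (Suc n - j) \<omega> else 0))
         + w (Suc n) \<omega>"
    \<comment> \<open>noise: i.i.d. N(0,1); (A1) input: i.i.d. uniform on [-delta, delta];
        inputs and noises mutually independent\<close>
    and indep: "prob_space.indep_vars M (\<lambda>_. borel) (case_sum u w) UNIV"
    and w_distr: "\<And>n. distributed M lborel (w n) (\<lambda>x. ennreal (normal_density 0 1 x))"
    and \<delta>_pos: "0 < \<delta>"
    and u_distr: "\<And>n. distributed M lborel (u n)
                     (\<lambda>x. indicator {-\<delta>..\<delta>} x / measure lborel {-\<delta>..\<delta>})"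
    \<comment> \<open>(A2)\<close>
    and A2: "\<And>z::complex. cmod z \<le> 1 \<Longrightarrow> 1 + (\<Sum>i\<in>{1..p0}. complex_of_real (a i) * z ^ i) \<noteq> 0"
    \<comment> \<open>(A3)\<close>
    and c_pos: "0 < c"
    and a_bd: "\<And>i. 1 \<le> i \<Longrightarrow> i \<le> p0 \<Longrightarrow> \<bar>a i\<bar> \<le> c"
    and b_bd: "\<And>j. 1 \<le> j \<Longrightarrow> j \<le> q0 \<Longrightarrow> \<bar>b j\<bar> \<le> c"
    and eps_pos: "0 < eps"
    and eps_small: "eps < 1 / (2 * (1 + real p0 * c))"
    \<comment> \<open>(A4)\<close>
    and pstar_pos: "0 < pstar" and qstar_pos: "0 < qstar"
    and A4: "p0 \<le> pstar" "q0 \<le> qstar"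
    \<comment> \<open>(A6)\<close>
    and c2_pos: "0 < c2"
    and A6: "\<And>q. q \<le> qstar \<Longrightarrow> AE \<omega> in M. eventually (\<lambda>n.
        lam_min (\<lambda>k. quant eps (y k \<omega>)) (\<lambda>k. u k \<omega>) pstar q n \<ge> c2 * (real n + 1)) sequentially"
    \<comment> \<open>constants c4 and gamma'\<close>
    and c4_pos: "0 < c4"
    and c4_bd: "AE \<omega> in M. eventually (\<lambda>n.
        lam_max (\<lambda>k. quant eps (y k \<omega>)) (\<lambda>k. u k \<omega>) pstar q0 n \<le> c4 * (real n + 1)) sequentially"
    and gamma_bd: "AE \<omega> in M. eventually (\<lambda>n. \<forall>q \<le> q0.
        vnorm (theta_tilde a b p0 q0 (\<lambda>k. quant eps (y k \<omega>)) (\<lambda>k. u k \<omega>) pstar q n) \<le> \<gamma>') sequentially"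
    \<comment> \<open>penalty sequence\<close>
    and \<beta>1_pos: "0 < \<beta>1" and \<beta>2: "0 < \<beta>2" "\<beta>2 < 1"
    and v_lower: "\<And>n. (5 * (1 + real pstar * c) * eps + \<beta>1) * real n \<le> v n"
    and v_upper: "\<And>n. v n \<le> \<beta>2 / real qstar * ((b q0)\<^sup>2 * c2
        - 2 * \<gamma>' * sqrt (c4 * (1 + real pstar * c) * eps) - 3 * (1 + real pstar * c) * eps) * real n"
  shows "AE \<omega> in M. (\<lambda>n. arg_min (\<lambda>q. Vcrit v (\<lambda>k. quant eps (y k \<omega>)) (\<lambda>k. u k \<omega>) n pstar q)
                                  (\<lambda>q. q \<le> qstar)) \<longlonglongrightarrow> q0"
proof -
  interpret prob_space M by fact
  define s where "s \<omega> k = quant eps (y k \<omega>)" for \<omega> k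
  have s_eq: "(\<lambda>k. quant eps (y k \<omega>)) = s \<omega>" for \<omega>
    by (simp add: s_def[abs_def])
  \<comment> \<open>The output error is at most \<open>eps / 2\<close>, and it enters once with
    coefficient 1 and \<open>p0\<close> times with coefficients bounded by \<open>c\<close>.\<close>
  define m where "m = (1 + real p0 * c) * (eps / 2)"
  define \<eta> where "\<eta> = (1 + real pstar * c) * eps"
  have p0c: "0 < 1 + real p0 * c" using c_pos by (simp add: add_pos_nonneg)
  have \<eta>: "0 < \<eta>" unfolding \<eta>_def using c_pos eps_pos by (simp add: add_pos_nonneg)
  have m0: "0 \<le> m" using p0c eps_pos by (simp add: m_def)
  \<comment> \<open>(A3) makes \<open>m \<le> 1\<close>, so that \<open>m\<^sup>2 \<le> m\<close>,
    and \<open>m\<close> is at most half of \<eta>.\<close>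
  have "(1 + real p0 * c) * eps \<le> \<eta>"
    unfolding \<eta>_def using c_pos eps_pos A4(1) by (intro mult_right_mono) auto
  moreover have "m \<le> 1"
    using eps_small p0c by (simp add: m_def field_simps)
  moreover have "m = (1 + real p0 * c) * eps / 2" by (simp add: m_def)
  ultimately have m\<eta>: "m\<^sup>2 \<le> \<eta>"
    unfolding power2_eq_square using m0 mult_left_le[of m m] \<eta> by linarith
  have avg: "AE \<omega> in M. \<forall>k<pstar + qstar. (\<lambda>n. (\<Sum>i<n.
      psi (s \<omega>) (\<lambda>k. u k \<omega>) pstar qstar i $ k * w (Suc i) \<omega>) / real n) \<longlonglongrightarrow> 0"
    using arx_noise_average[OF y0 sys A2 indep w_distr u_distr eps_pos, of _ pstar qstar]
    unfolding s_eq AE_all_countable by auto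
  have A6': "AE \<omega> in M. \<forall>q. q \<le> qstar \<longrightarrow> eventually (\<lambda>n.
      c2 * (real n + 1) \<le> lam_min (s \<omega>) (\<lambda>k. u k \<omega>) pstar q n) sequentially"
    using A6 unfolding s_eq AE_all_countable by auto
  show ?thesis
    using avg A6' c4_bd gamma_bd unfolding s_eq
  proof eventually_elim
    case (elim \<omega>)
    let ?u = "\<lambda>k. u k \<omega>"
    define t where "t = initial_term a b p0 q0 (y 0 \<omega>) (u 0 \<omega>)"
    \<comment> \<open>An initial term requires a lag equal to \<open>Suc i\<close>, which exceeds
      both orders from here on.\<close>
    have t0: "t i = 0" if "max p0 q0 \<le> i" for i
      using that by (auto simp: t_def initial_term_def intro!: sum.neutral)
    have "eventually (\<lambda>n. arg_min (Vcrit v (s \<omega>) ?u n pstar) (\<lambda>q. q \<le> qstar) = q0) sequentially"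
    proof (rule arg_min_Vcrit_eventually[where \<eta> = \<eta> and m = m
          and d = "quant_noise a p0 (s \<omega>) (\<lambda>k. y k \<omega>)" and W = "\<lambda>i. w (Suc i) \<omega> + t i"])
      show "s \<omega> (Suc i) = theta_bar a b p0 q0 pstar q0 \<bullet> psi (s \<omega>) ?u pstar q0 i
          + quant_noise a p0 (s \<omega>) (\<lambda>k. y k \<omega>) i + (w (Suc i) \<omega> + t i)" for i
        unfolding t_def by (rule quantized_regression[where w = "\<lambda>k. w k \<omega>"]) (use sys A4 in auto)
      show "\<bar>quant_noise a p0 (s \<omega>) (\<lambda>k. y k \<omega>) i\<bar> \<le> m" for i
        unfolding m_def by (rule quant_noise_bound) (use a_bd quant_error[OF eps_pos] in \<open>auto simp: s_def\<close>)
      show "(\<lambda>n. (\<Sum>i<n. psi (s \<omega>) ?u pstar qstar i $ k * (w (Suc i) \<omega> + t i)) / real n) \<longlonglongrightarrow> 0"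
        if "k < pstar + qstar" for k
      proof -
        have "(\<lambda>n. (\<Sum>i<n. psi (s \<omega>) ?u pstar qstar i $ k * w (Suc i) \<omega>) / real n
            + (\<Sum>i<n. psi (s \<omega>) ?u pstar qstar i $ k * t i) / real n) \<longlonglongrightarrow> 0 + 0"
          using elim(1) that by (intro tendsto_add[OF _ average_eventually_zero[of "max p0 q0"]])
            (simp_all add: t0)
        then show ?thesis
          by (simp add: distrib_left sum.distrib add_divide_distrib)
      qed
      show "(5 * \<eta> + \<beta>1) * real n \<le> v n" for n
        using v_lower[of n] by (simp add: \<eta>_def algebra_simps)
      show "v n \<le> \<beta>2 / real qstar * ((b q0)\<^sup>2 * c2 - 2 * \<gamma>' * sqrt (c4 * \<eta>) - 3 * \<eta>) * real n" for n
        using v_upper[of n] by (simp add: \<eta>_def algebra_simps)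
    qed (use elim m\<eta> \<eta> q0_pos A4 pstar_pos c2_pos c4_pos \<beta>1_pos \<beta>2 in auto)
    then show ?case by (rule tendsto_eventually)
  qed
qed

end
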